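(* Let $\{c_n\}_{n=1}^{\infty}$ be a sequence of real numbers and let $\{d_n\}_{n=1}^{\infty}$ be a positive chain sequence with maximal parameter sequence $\{M_n\}_{n=0}^{\infty}$. Let $\mathcal{N}$ be the moment functional associated with $\{c_n\}$ and $\{d_n\}$ (defined in the context). Then there exists a nontrivial probability measure $\mu$ on the unit circle $\mathcal{C}=\{\zeta\in\mathbb{C}: |\zeta|=1\}$ such that \[ \mathcal{N}[\zeta^{-n}] = \int_{\mathcal{C}} \zeta^{-n}(1-\zeta)\, d\mu(\zeta), \qquad n = 0,\pm 1,\pm 2,\ldots, \] and such that, if $M_0>0$, then $\mu$ has a pure point of mass $M_0$ at $z=1$.
   Context: A sequence $\{d_n\}_{n=1}^{\infty}$ is a positive chain sequence if there is a sequence $\{g_n\}_{n=0}^{\infty}$ (a parameter sequence) with $0\le g_0<1$, $0<g_n<1$ for $n\ge1$, and $d_n=(1-g_{n-1})g_n$ for all $n\ge1$. The maximal parameter sequence $\{M_n\}_{n=0}^{\infty}$ is the parameter sequence such that $g_n\le M_n$ for all $n\geq 0$ and every parameter sequence $\{g_n\}$ of $\{d_n\}$. A probability measure on the unit circle is nontrivial if its support is infinite. Given a real sequence $\{c_n\}_{n\ge1}$ and a positive chain sequence $\{d_n\}_{n\ge1}$, define polynomials by $R_0(z)=1$, $R_1(z)=(1+ic_1)z+(1-ic_1)$, $Q_0(z)=0$, $Q_1(z)=2d_1$, and for $n\ge1$ \[ R_{n+1}(z)=[(1+ic_{n+1})z+(1-ic_{n+1})]R_n(z)-4d_{n+1}zR_{n-1}(z),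 \] \[ Q_{n+1}(z)=[(1+ic_{n+1})z+(1-ic_{n+1})]Q_n(z)-4d_{n+1}zQ_{n-1}(z). \] There are unique formal series $E_0(z)=-\nu_1-\nu_2z-\nu_3z^2-\cdots$ and $E_\infty(z)=\frac{\nu_0}{z}+\frac{\nu_{-1}}{z^2}+\frac{\nu_{-2}}{z^3}+\cdots$ such that, for every $n\ge0$, $E_0(z)-\frac{Q_n(z)}{R_n(z)}=O(z^n)$ (expanding about the origin) and $E_\infty(z)-\frac{Q_n(z)}{R_n(z)}=O\big((1/z)^{n+1}\big)$ (expanding about infinity). This defines the double sequence of complex numbers $\{\nu_n\}_{n=-\infty}^{\infty}$. The moment functional $\mathcal{N}$ associated with $\{c_n\}$ and $\{d_n\}$ is the linear functional on Laurent polynomials given by $\mathcal{N}[\zeta^{-n}]=\nu_n$, $n=0,\pm1,\pm2,\ldots$. *)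

theory Defs
  imports
    "HOL-Probability.Probability"
    "HOL-Computational_Algebra.Formal_Laurent_Series"
    "HOL-Library.Poly_Mapping"
begin

section \<open>Positive chain sequences\<close>

text \<open>The sequences $(c_n)$ and $(d_n)$ start at index 1; the values at 0 are never used.\<close>

definition parameter_sequence :: "(nat \<Rightarrow> real) \<Rightarrow> (nat \<Rightarrow> real) \<Rightarrow> bool" where
  "parameter_sequence d g \<longleftrightarrow>
     0 \<le> g 0 \<and> g 0 < 1 \<and>
     (\<forall>n\<ge>1. 0 < g n \<and> g n < 1) \<and>
     (\<forall>n\<ge>1. d n = (1 - g (n - 1)) * g n)"

definition positive_chain_sequence :: "(nat \<Rightarrow> real) \<Rightarrow> bool" where
  "positive_chain_sequence d \<longleftrightarrow> (\<exists>g. parameter_sequence d g)"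

definition maximal_parameter_sequence :: "(nat \<Rightarrow> real) \<Rightarrow> (nat \<Rightarrow> real) \<Rightarrow> bool" where
  "maximal_parameter_sequence d M \<longleftrightarrow>
     parameter_sequence d M \<and>
     (\<forall>g. parameter_sequence d g \<longrightarrow> (\<forall>n. g n \<le> M n))"

section \<open>Probability measures on the unit circle\<close>

definition measure_support :: "'a::topological_space measure \<Rightarrow> 'a set" where
  "measure_support \<mu> =
     {x \<in> space \<mu>. \<forall>U. open U \<longrightarrow> x \<in> U \<longrightarrow> emeasure \<mu> (U \<inter> space \<mu>) > 0}"

abbreviation unit_circle :: "complex set" where
  "unit_circle \<equiv> sphere 0 1"

definition nontrivial_circle_probability :: "complex measure \<Rightarrow> bool" where
  "nontrivial_circle_probability \<mu> \<longleftrightarrow>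
     sets \<mu> = sets (restrict_space borel unit_circle) \<and>
     prob_space \<mu> \<and> infinite (measure_support \<mu>)"

section \<open>The polynomials and the moment functional\<close>

fun Rpoly :: "(nat \<Rightarrow> real) \<Rightarrow> (nat \<Rightarrow> real) \<Rightarrow> nat \<Rightarrow> complex poly" where
  "Rpoly c d 0 = 1"
| "Rpoly c d (Suc 0) = [:1 - \<i> * c 1, 1 + \<i> * c 1:]"
| "Rpoly c d (Suc (Suc n)) =
     [:1 - \<i> * c (n + 2), 1 + \<i> * c (n + 2):] * Rpoly c d (Suc n)
     - [:0, 4 * of_real (d (n + 2)):] * Rpoly c d n"

fun Qpoly :: "(nat \<Rightarrow> real) \<Rightarrow> (nat \<Rightarrow> real) \<Rightarrow> nat \<Rightarrow> complex poly" where
  "Qpoly c d 0 = 0"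
| "Qpoly c d (Suc 0) = [:2 * of_real (d 1):]"
| "Qpoly c d (Suc (Suc n)) =
     [:1 - \<i> * c (n + 2), 1 + \<i> * c (n + 2):] * Qpoly c d (Suc n)
     - [:0, 4 * of_real (d (n + 2)):] * Qpoly c d n"

text \<open>
  Evaluation of a polynomial at a formal Laurent series. At \<^term>\<open>fls_X\<close> it gives the
  expansion about the origin. At \<^term>\<open>fls_X_inv\<close> it gives the expansion about infinity:
  there \<^term>\<open>fls_X\<close> stands for $1/z$.
\<close>
definition fls_eval :: "complex poly \<Rightarrow> complex fls \<Rightarrow> complex fls" where
  "fls_eval p t = poly (map_poly fls_const p) t"

definition fls_ratio :: "(nat \<Rightarrow> real) \<Rightarrow> (nat \<Rightarrow> real) \<Rightarrow> nat \<Rightarrow> complex fls \<Rightarrow> complex fls" where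
  "fls_ratio c d n t = fls_eval (Qpoly c d n) t / fls_eval (Rpoly c d n) t"

text \<open>$f = O(w^n)$, where $w$ is the variable that \<^term>\<open>fls_X\<close> stands for.\<close>
definition fls_bigo :: "complex fls \<Rightarrow> nat \<Rightarrow> bool" where
  "fls_bigo f n \<longleftrightarrow> (\<forall>k < int n. fls_nth f k = 0)"

definition E_zero :: "(int \<Rightarrow> complex) \<Rightarrow> complex fls" where
  "E_zero \<nu> = fps_to_fls (Abs_fps (\<lambda>k. - \<nu> (int k + 1)))"

definition E_infinity :: "(int \<Rightarrow> complex) \<Rightarrow> complex fls" where
  "E_infinity \<nu> = fls_X * fps_to_fls (Abs_fps (\<lambda>k. \<nu> (- int k)))"

definition is_moment_sequence ::
    "(nat \<Rightarrow> real) \<Rightarrow> (nat \<Rightarrow> real) \<Rightarrow> (int \<Rightarrow> complex) \<Rightarrow> bool" where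
  "is_moment_sequence c d \<nu> \<longleftrightarrow>
     (\<forall>n. fls_bigo (E_zero \<nu> - fls_ratio c d n fls_X) n \<and>
          fls_bigo (E_infinity \<nu> - fls_ratio c d n fls_X_inv) (n + 1))"

text \<open>The description is meaningful by \<open>ex1_moment_sequence\<close> below.\<close>

definition moment_sequence :: "(nat \<Rightarrow> real) \<Rightarrow> (nat \<Rightarrow> real) \<Rightarrow> int \<Rightarrow> complex" where
  "moment_sequence c d = (THE \<nu>. is_moment_sequence c d \<nu>)"

text \<open>
  Laurent polynomials are finitely supported functions from exponents to coefficients;
  \<^term>\<open>Poly_Mapping.single k 1\<close> is the monomial $\zeta^k$. The functional sends
  $\zeta^{-n}$ to $\nu_n$.
\<close>
definition moment_functional ::
    "(nat \<Rightarrow> real) \<Rightarrow> (nat \<Rightarrow> real) \<Rightarrow> (int \<Rightarrow>\<^sub>0 complex) \<Rightarrow> complex" where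
  "moment_functional c d L =
     (\<Sum>k\<in>Poly_Mapping.keys L. Poly_Mapping.lookup L k * moment_sequence c d (- k))"

lemma moment_functional_monomial:
  "moment_functional c d (Poly_Mapping.single (- n) 1) = moment_sequence c d n"
  by (simp add: moment_functional_def)

section \<open>Existence and uniqueness of the moment sequence\<close>

lemma fls_eval_pCons: "fls_eval (pCons a p) t = fls_const a + t * fls_eval p t"
  by (simp add: fls_eval_def map_poly_pCons)

lemma fls_eval_0: "fls_eval 0 t = 0"
  by (simp add: fls_eval_def)

lemma fls_eval_1: "fls_eval 1 t = 1"
  by (simp add: fls_eval_def)

lemma fls_eval_add: "fls_eval (p + q) t = fls_eval p t + fls_eval q t"
proof (induction p arbitrary: q)
  case (pCons a p)
  obtain b q' where "q = pCons b q'" by (cases q)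
  with pCons.IH[of q'] show ?case
    by (simp add: fls_eval_pCons algebra_simps fls_plus_const[symmetric])
qed (simp add: fls_eval_0)

lemma fls_eval_smult: "fls_eval (smult a p) t = fls_const a * fls_eval p t"
  by (induction p) (simp_all add: fls_eval_0 fls_eval_pCons algebra_simps
      fls_const_mult_const[symmetric] del: fls_const_mult_const)

lemma fls_eval_mult: "fls_eval (p * q) t = fls_eval p t * fls_eval q t"
  by (induction p) (simp_all add: fls_eval_0 fls_eval_pCons fls_eval_add fls_eval_smult algebra_simps)

lemma fls_eval_diff: "fls_eval (p - q) t = fls_eval p t - fls_eval q t"
  using fls_eval_add[of "p - q" q t] by simp

lemma fls_eval_recurrence:
  fixes c d :: "nat \<Rightarrow> real" and t :: "complex fls"
  defines "a \<equiv> \<lambda>n. fls_const (1 - \<i> * c n) + t * fls_const (1 + \<i> * c n)"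
    and "e \<equiv> \<lambda>n. t * fls_const (4 * of_real (d n))"
  shows "fls_eval (Rpoly c d (Suc (Suc n))) t =
           a (n + 2) * fls_eval (Rpoly c d (Suc n)) t - e (n + 2) * fls_eval (Rpoly c d n) t"
    and "fls_eval (Qpoly c d (Suc (Suc n))) t =
           a (n + 2) * fls_eval (Qpoly c d (Suc n)) t - e (n + 2) * fls_eval (Qpoly c d n) t"
  unfolding a_def e_def
  by (simp_all only: Rpoly.simps Qpoly.simps fls_eval_diff fls_eval_mult)
     (simp_all add: fls_eval_pCons fls_eval_0)

lemma fls_eval_determinant:
  "\<exists>K. fls_eval (Qpoly c d (Suc n)) t * fls_eval (Rpoly c d n) t
     - fls_eval (Qpoly c d n) t * fls_eval (Rpoly c d (Suc n)) t = fls_const K * t ^ n"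
proof (induction n)
  case 0
  show ?case
    by (rule exI[of _ "2 * of_real (d 1)"]) (simp add: fls_eval_pCons fls_eval_0 fls_eval_1)
next
  case (Suc n)
  then obtain K where K: "fls_eval (Qpoly c d (Suc n)) t * fls_eval (Rpoly c d n) t
     - fls_eval (Qpoly c d n) t * fls_eval (Rpoly c d (Suc n)) t = fls_const K * t ^ n" by blast
  have "fls_eval (Qpoly c d (Suc (Suc n))) t * fls_eval (Rpoly c d (Suc n)) t
     - fls_eval (Qpoly c d (Suc n)) t * fls_eval (Rpoly c d (Suc (Suc n))) t
     = t * fls_const (4 * of_real (d (n + 2))) *
       (fls_eval (Qpoly c d (Suc n)) t * fls_eval (Rpoly c d n) t
     - fls_eval (Qpoly c d n) t * fls_eval (Rpoly c d (Suc n)) t)"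
    unfolding fls_eval_recurrence by (simp only: algebra_simps)
  also have "\<dots> = fls_const (4 * of_real (d (n + 2)) * K) * t ^ Suc n"
    unfolding K fls_const_mult_const[symmetric] power_Suc by (simp only: mult_ac)
  finally show ?case by blast
qed

lemma one_pm_i_nonzero: "1 - \<i> * complex_of_real x \<noteq> 0" "1 + \<i> * complex_of_real x \<noteq> 0"
  by (simp_all add: complex_eq_iff)

lemma Rpoly_lowest_fls_X:
  "fls_nth (fls_eval (Rpoly c d n) fls_X) 0 \<noteq> 0 \<and>
   (\<forall>k<0. fls_nth (fls_eval (Rpoly c d n) fls_X) k = 0)"
proof (induction n rule: induct_nat_012)
  case 1
  then show ?case
    using one_pm_i_nonzero[of "c 1"]
    by (auto simp: fls_eval_pCons fls_eval_0 fls_X_times_conv_shift)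
next
  case (ge2 n)
  then show ?case
    using one_pm_i_nonzero[of "c (n + 2)"] unfolding fls_eval_recurrence
    by (simp add: algebra_simps fls_X_times_conv_shift
        fls_shifted_times_simps)
qed (simp add: fls_eval_1)

lemma Rpoly_lowest_fls_X_inv:
  "fls_nth (fls_eval (Rpoly c d n) fls_X_inv) (- int n) \<noteq> 0 \<and>
   (\<forall>k < - int n. fls_nth (fls_eval (Rpoly c d n) fls_X_inv) k = 0)"
proof (induction n rule: induct_nat_012)
  case 1
  then show ?case
    using one_pm_i_nonzero[of "c 1"]
    by (auto simp: fls_eval_pCons fls_eval_0 fls_X_inv_times_conv_shift)
next
  case (ge2 n)
  then have "(1 + \<i> * c (n + 2)) * fls_nth (fls_eval (Rpoly c d (Suc n)) fls_X_inv) (- int (Suc n)) \<noteq> 0"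
    using one_pm_i_nonzero(2)[of "c (n + 2)"] by (intro no_zero_divisors) blast+
  then show ?case
    using ge2 unfolding fls_eval_recurrence
    by (simp add: algebra_simps fls_X_inv_times_conv_shift fls_shifted_times_simps)
qed (simp add: fls_eval_1)

lemma fls_ratio_Suc:
  assumes "t = fls_X \<and> s = 0 \<or> t = fls_X_inv \<and> s = 1"
  shows "\<forall>k < int (n + s). fls_nth (fls_ratio c d (Suc n) t) k = fls_nth (fls_ratio c d n t) k"
proof -
  define r q where "r = (\<lambda>n. fls_eval (Rpoly c d n) t)" and "q = (\<lambda>n. fls_eval (Qpoly c d n) t)"
  have sub: "r m \<noteq> 0 \<and> fls_subdegree (r m) = - int (s * m)" for m
  proof -
    have "fls_nth (r m) (- int (s * m)) \<noteq> 0 \<and> (\<forall>k < - int (s * m). fls_nth (r m) k = 0)"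
      using assms Rpoly_lowest_fls_X[of c d m] Rpoly_lowest_fls_X_inv[of c d m] 
      by (auto simp: r_def)
    then show ?thesis by (auto intro!: fls_subdegree_eqI)
  qed
  obtain K where K: "q (Suc n) * r n - q n * r (Suc n) = fls_const K * t ^ n"
    using fls_eval_determinant[of c d n t] by (auto simp: r_def q_def)
  have t: "t \<noteq> 0" "fls_subdegree (t ^ n) = (1 - 2 * int s) * int n"
    using assms by auto
  have "fls_ratio c d (Suc n) t - fls_ratio c d n t = q (Suc n) / r (Suc n) - q n / r n"
    by (simp only: fls_ratio_def r_def q_def)
  also have "\<dots> = (q (Suc n) * r n - q n * r (Suc n)) / (r (Suc n) * r n)"
    using sub[of n] sub[of "Suc n"] by (intro diff_frac_eq) auto
  also have "\<dots> = fls_const K * t ^ n / (r n * r (Suc n))"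
    unfolding K by (simp only: mult.commute[of "r (Suc n)"])
  finally have diff: "fls_ratio c d (Suc n) t - fls_ratio c d n t = fls_const K * t ^ n / (r n * r (Suc n))" .
  have "fls_nth (fls_const K * t ^ n / (r n * r (Suc n))) k = 0" if "k < int (n + s)" for k
  proof (cases "K = 0")
    case False
    have "fls_subdegree (fls_const K * t ^ n / (r n * r (Suc n))) =
        (1 - 2 * int s) * int n + int (s * n) + int (s * Suc n)"
      using sub[of n] sub[of "Suc n"] t False by (simp add: fls_divide_subdegree)
    also have "\<dots> = int (n + s)" by (simp add: algebra_simps)
    finally show ?thesis using that by simp
  qed simp
  then show ?thesis
    unfolding diff[symmetric] fls_minus_nth right_minus_eq by blast
qed

lemma fls_ratio_stable:
  assumes "t = fls_X \<and> s = 0 \<or> t = fls_X_inv \<and> s = 1"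
    and "n \<le> m" and "k < int (n + s)"
  shows "fls_nth (fls_ratio c d m t) k = fls_nth (fls_ratio c d n t) k"
  using assms(2)
proof (induction m rule: dec_induct)
  case (step m)
  then have "k < int (m + s)" using assms(3) by linarith
  then show ?case using fls_ratio_Suc[OF assms(1), of m c d] step by simp
qed simp

lemma fls_ratio_below:
  assumes "t = fls_X \<and> s = 0 \<or> t = fls_X_inv \<and> s = 1" and "k < int s"
  shows "fls_nth (fls_ratio c d m t) k = 0"
  using fls_ratio_stable[OF assms(1), of 0 m k c d] assms(2)
  by (simp add: fls_ratio_def fls_eval_0)

lemma E_zero_nth: "fls_nth (E_zero \<nu>) k = (if k < 0 then 0 else - \<nu> (k + 1))"
  by (simp add: E_zero_def)

lemma E_infinity_nth: "fls_nth (E_infinity \<nu>) k = (if k < 1 then 0 else \<nu> (1 - k))"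
  by (simp add: E_infinity_def fls_X_times_conv_shift)

lemma is_moment_sequence_iff:
  "is_moment_sequence c d \<nu> \<longleftrightarrow>
     (\<forall>k. \<nu> (int k + 1) = - fls_nth (fls_ratio c d (k + 1) fls_X) k) \<and>
     (\<forall>k. \<nu> (- int k) = fls_nth (fls_ratio c d (k + 1) fls_X_inv) (int k + 1))"
  (is "?L \<longleftrightarrow> ?A \<and> ?B")
proof
  assume L: ?L
  have "\<nu> (int k + 1) = - fls_nth (fls_ratio c d (k + 1) fls_X) k" for k
  proof -
    have "fls_nth (E_zero \<nu> - fls_ratio c d (k + 1) fls_X) (int k) = 0"
      using L[unfolded is_moment_sequence_def, THEN spec, of "k + 1", THEN conjunct1]
      by (simp add: fls_bigo_def del: fls_minus_nth)
    then have "- \<nu> (int k + 1) = fls_nth (fls_ratio c d (k + 1) fls_X) k"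
      by (simp only: fls_minus_nth E_zero_nth right_minus_eq) simp
    then show ?thesis by (metis minus_minus)
  qed
  moreover have "\<nu> (- int k) = fls_nth (fls_ratio c d (k + 1) fls_X_inv) (int k + 1)" for k
  proof -
    have "fls_nth (E_infinity \<nu> - fls_ratio c d (k + 1) fls_X_inv) (int k + 1) = 0"
      using L[unfolded is_moment_sequence_def, THEN spec, of "k + 1", THEN conjunct2]
      by (simp add: fls_bigo_def del: fls_minus_nth)
    then show ?thesis by (simp add: E_infinity_nth)
  qed
  ultimately show "?A \<and> ?B" by blast
next
  assume AB: "?A \<and> ?B"
  have "fls_nth (E_zero \<nu>) k = fls_nth (fls_ratio c d n fls_X) k" if "k < int n" for n k
  proof (cases "k < 0")
    case True
    then show ?thesis using fls_ratio_below[of fls_X 0 k c d n] by (simp add: E_zero_nth)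
  next
    case False
    then obtain j where j: "k = int j" by (metis nonneg_int_cases not_less)
    have "fls_nth (fls_ratio c d n fls_X) k = fls_nth (fls_ratio c d (j + 1) fls_X) k"
      using that j by (intro fls_ratio_stable[where s = 0]) auto
    then show ?thesis using AB j by (simp add: E_zero_nth)
  qed
  moreover have "fls_nth (E_infinity \<nu>) k = fls_nth (fls_ratio c d n fls_X_inv) k"
    if "k < int n + 1" for n k
  proof (cases "k < 1")
    case True
    then show ?thesis using fls_ratio_below[of fls_X_inv 1 k c d n] by (simp add: E_infinity_nth)
  next
    case False
    then obtain j where j: "k = int j + 1"
      by (metis add.commute diff_add_cancel le_diff_eq add_0 nonneg_int_cases not_less)
    have "fls_nth (fls_ratio c d n fls_X_inv) k = fls_nth (fls_ratio c d (j + 1) fls_X_inv) k"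
      using that j by (intro fls_ratio_stable[where s = 1]) auto
    then show ?thesis using AB j by (simp add: E_infinity_nth)
  qed
  ultimately show ?L by (simp add: is_moment_sequence_def fls_bigo_def)
qed

lemma ex1_moment_sequence: "\<exists>!\<nu>. is_moment_sequence c d \<nu>"
proof (rule ex1I)
  define f where "f = (\<lambda>j::int. if j \<ge> 1
      then - fls_nth (fls_ratio c d (nat j) fls_X) (j - 1)
      else fls_nth (fls_ratio c d (nat (1 - j)) fls_X_inv) (1 - j))"
  have nats: "nat (int k + 1) = Suc k" "nat (1 + int k) = Suc k" for k by simp_all
  show "is_moment_sequence c d f"
    unfolding is_moment_sequence_iff by (auto simp: f_def nats add.commute)
  fix \<nu> assume "is_moment_sequence c d \<nu>"
  moreover note \<open>is_moment_sequence c d f\<close>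
  moreover have "(\<exists>k. j = int k + 1) \<or> (\<exists>k. j = - int k)" for j by presburger
  ultimately show "\<nu> = f"
    unfolding is_moment_sequence_iff by (metis ext)
qed

lemma is_moment_sequence_moment_sequence: "is_moment_sequence c d (moment_sequence c d)"
  unfolding moment_sequence_def by (rule theI'[OF ex1_moment_sequence])

end

theory Submission
  imports Defs
begin

text \<open>
  Let $L$ be the functional with $L[1] = 1$ and $\mathcal{N}[f] = L[(1-\zeta) f]$. The Pade
  conditions say that $R_n$ is orthogonal, with respect to $L$, to $(\zeta - 1)q$ for all $q$ of
  degree less than $n$; hence $L[R_n \overline{q}] = h_n \overline{q(1)}$ for $\deg q \le n$, where
  $h_n = L[R_n]$. Both $2^{-n} h_n$ and $2^{-n} R_n(1)$ satisfy $y_{n+1} = y_n - d_{n+1} y_{n-1}$.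
  From a parameter sequence one sees that $s_n = h_n / R_n(1)$ is positive and strictly decreasing,
  and its limit is $M_0$. The Gram matrix of $u_n = R_n / R_n(1)$ has the entries
  $s_{\max(j,k)}$, so $L$ is positive definite and $L[|p|^2] \ge s_n |p(1)|^2$ for $\deg p \le n$.
  A measure that represents $L$ is obtained from Fejer means and Helly's theorem; it has infinite
  support by strict positivity, and its mass at 1 is $\lim s_n = M_0$.
\<close>

section \<open>Polynomials acting on two-sided sequences\<close>

text \<open>If \<open>f k\<close> is the value of a functional at $\zeta^{-k}$, then \<open>poly_act p f k\<close> is its value at
  $\zeta^{-k} p(\zeta)$.\<close>
definition poly_act :: "complex poly \<Rightarrow> (int \<Rightarrow> complex) \<Rightarrow> int \<Rightarrow> complex" where
  "poly_act p f k = (\<Sum>i\<le>degree p. coeff p i * f (k - int i))"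

lemma poly_act_bound:
  assumes "degree p \<le> n"
  shows "poly_act p f k = (\<Sum>i\<le>n. coeff p i * f (k - int i))"
  unfolding poly_act_def using assms
  by (intro sum.mono_neutral_left) (auto simp: coeff_eq_0)

lemma poly_act_0 [simp]: "poly_act 0 f k = 0"
  by (simp add: poly_act_def)

lemma poly_act_pCons [simp]: "poly_act (pCons a p) f k = a * f k + poly_act p f (k - 1)"
proof -
  have "poly_act (pCons a p) f k = (\<Sum>i\<le>Suc (degree p). coeff (pCons a p) i * f (k - int i))"
    by (rule poly_act_bound) (simp add: degree_pCons_le)
  also have "\<dots> = a * f k + (\<Sum>i\<le>degree p. coeff p i * f (k - int (Suc i)))"
    by (subst sum.atMost_Suc_shift) simp
  finally show ?thesis by (simp add: poly_act_def algebra_simps)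
qed

lemma poly_act_1 [simp]: "poly_act 1 f k = f k"
  by (simp add: poly_act_def)

lemma poly_act_smult [simp]: "poly_act (smult a p) f k = a * poly_act p f k"
  by (induction p arbitrary: k) (auto simp: algebra_simps)

lemma poly_act_add [simp]: "poly_act (p + q) f k = poly_act p f k + poly_act q f k"
proof (induction p arbitrary: q k)
  case (pCons a p)
  then show ?case by (cases q) (simp add: algebra_simps)
qed simp

lemma poly_act_diff [simp]: "poly_act (p - q) f k = poly_act p f k - poly_act q f k"
  using poly_act_add[of "p - q" q f k] by simp

lemma poly_act_diff_right: "poly_act p (\<lambda>k. f k - g k) k = poly_act p f k - poly_act p g k"
  by (simp add: poly_act_def algebra_simps sum_subtractf)

lemma poly_act_shift: "poly_act p (\<lambda>j. f (j + a)) k = poly_act p f (k + a)"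
  by (simp add: poly_act_def algebra_simps)

section \<open>Coefficients of a polynomial times a Laurent series\<close>

lemma fls_eval_mult_nth_X:
  "fls_nth (fls_eval p fls_X * F) k = poly_act p (fls_nth F) k"
proof (induction p arbitrary: k)
  case (pCons a p)
  have "fls_eval (pCons a p) fls_X * F = fls_const a * F + fls_X * (fls_eval p fls_X * F)"
    by (simp only: fls_eval_pCons distrib_right mult.assoc)
  then show ?case
    using pCons.IH by (simp add: fls_X_times_conv_shift(1))
qed (simp add: fls_eval_0)

text \<open>Here \<open>fls_X\<close> stands for 1/z, so index \<open>- k\<close> carries the power
  z^k. With this reading, multiplication by z is the same shift from \<open>k\<close> to
  \<open>k - 1\<close> as at the origin.\<close>

lemma fls_eval_mult_nth_X_inv:
  "fls_nth (fls_eval p fls_X_inv * F) (- k) = poly_act p (\<lambda>k. fls_nth F (- k)) k"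
proof (induction p arbitrary: k)
  case (pCons a p)
  have "fls_eval (pCons a p) fls_X_inv * F =
      fls_const a * F + fls_X_inv * (fls_eval p fls_X_inv * F)"
    by (simp only: fls_eval_pCons distrib_right mult.assoc)
  then show ?case
    using pCons.IH[of "k - 1"] by (simp add: fls_X_inv_times_conv_shift(1))
qed (simp add: fls_eval_0)

section \<open>Degree and self-reciprocity of R_n\<close>

lemma degree_Rpoly: "degree (Rpoly c d n) \<le> n"
proof (induction n rule: induct_nat_012)
  case (ge2 n)
  have "degree ([:1 - \<i> * c (n + 2), 1 + \<i> * c (n + 2):] * Rpoly c d (Suc n)) \<le> 1 + Suc n"
    by (rule order_trans[OF degree_mult_le]) (use ge2 in simp)
  moreover have "degree ([:0, 4 * of_real (d (n + 2)):] * Rpoly c d n) \<le> 1 + n"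
    by (rule order_trans[OF degree_mult_le]) (use ge2 in \<open>simp split: if_splits\<close>)
  ultimately show ?case
    unfolding Rpoly.simps by (intro degree_diff_le) auto
qed auto

lemma poly_act_Rpoly_Suc_Suc:
  "poly_act (Rpoly c d (Suc (Suc n))) f k =
     (1 - \<i> * c (n + 2)) * poly_act (Rpoly c d (Suc n)) f k
     + (1 + \<i> * c (n + 2)) * poly_act (Rpoly c d (Suc n)) f (k - 1)
     - 4 * of_real (d (n + 2)) * poly_act (Rpoly c d n) f (k - 1)"
  by (simp add: algebra_simps)

lemma coeff_Rpoly_Suc_Suc:
  "coeff (Rpoly c d (Suc (Suc n))) j =
     (1 - \<i> * c (n + 2)) * coeff (Rpoly c d (Suc n)) j
     + (if j = 0 then 0 else (1 + \<i> * c (n + 2)) * coeff (Rpoly c d (Suc n)) (j - 1)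
     - 4 * d (n + 2) * coeff (Rpoly c d n) (j - 1))"
  by (cases j) (simp_all add: algebra_simps)

lemma coeff_Rpoly_0: "coeff (Rpoly c d n) 0 \<noteq> 0"
  by (induction n rule: induct_nat_012)
     (use one_pm_i_nonzero(1) in \<open>auto simp: coeff_Rpoly_Suc_Suc simp del: Rpoly.simps(3)\<close>)

text \<open>Self-reciprocity passes through the recurrence: the two coefficients of each linear
  factor are conjugate to each other, and 4 d z is symmetric as a polynomial of formal degree two
  with real coefficients.\<close>

lemma cnj_coeff_Rpoly: "j \<le> n \<Longrightarrow> cnj (coeff (Rpoly c d n) j) = coeff (Rpoly c d n) (n - j)"
proof (induction n arbitrary: j rule: induct_nat_012)
  case 1
  then show ?case by (cases j) auto
next
  case (ge2 n)
  have z: "coeff (Rpoly c d n) (Suc n) = 0" "coeff (Rpoly c d (Suc n)) (Suc (Suc n)) = 0"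
    using degree_Rpoly[of c d n] degree_Rpoly[of c d "Suc n"] by (auto intro!: coeff_eq_0)
  consider "j = 0" | "j = Suc (Suc n)" | i where "j = Suc i" "i \<le> n"
    using ge2.prems by (metis Suc_le_mono le_SucE not0_implies_Suc)
  then show ?case
  proof cases
    case 1
    then show ?thesis
      using z ge2.IH(2)[of 0]
      by (simp add: coeff_Rpoly_Suc_Suc del: Rpoly.simps(3))
  next
    case 2
    then show ?thesis
      using z ge2.IH(2)[of "Suc n"]
      by (simp add: coeff_Rpoly_Suc_Suc del: Rpoly.simps(3))
  next
    case 3
    then have e: "Suc (Suc n) - j = Suc (n - i)" "Suc n - i = Suc (n - i)"
      by auto
    then show ?thesis
      using ge2.IH(2)[of "Suc i"] ge2.IH(2)[of i] ge2.IH(1)[of i] 3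
      by (simp add: coeff_Rpoly_Suc_Suc e del: Rpoly.simps(3))
  qed
qed simp

section \<open>Orthogonality and symmetry of the moment sequence\<close>

text \<open>Multiplication by R_n clears the quotient. At the origin it keeps the order n of the
  error; at infinity R_n grows like z^n, so an error O((1/z)^(n+1)) retains only negative powers of
  z.\<close>

lemma Pade_equations:
  assumes "is_moment_sequence c d \<nu>"
  shows "k < int n \<Longrightarrow>
           poly_act (Rpoly c d n) (fls_nth (E_zero \<nu>)) k = poly_act (Qpoly c d n) (fls_nth 1) k"
    and "k \<ge> 0 \<Longrightarrow>
           poly_act (Rpoly c d n) (\<lambda>k. fls_nth (E_infinity \<nu>) (- k)) k =
           poly_act (Qpoly c d n) (fls_nth 1) k"
proof -
  have ratio: "fls_eval (Rpoly c d n) t * (E - fls_ratio c d n t) =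
      fls_eval (Rpoly c d n) t * E - fls_eval (Qpoly c d n) t * 1"
    if "fls_eval (Rpoly c d n) t \<noteq> 0" for E t
    using that by (simp add: fls_ratio_def right_diff_distrib)
  have nz: "fls_eval (Rpoly c d n) fls_X \<noteq> 0" "fls_eval (Rpoly c d n) fls_X_inv \<noteq> 0"
    using Rpoly_lowest_fls_X[of c d n] Rpoly_lowest_fls_X_inv[of c d n] by auto
  have b0: "fls_nth (E_zero \<nu> - fls_ratio c d n fls_X) j = 0" if "j < int n" for j
    using assms that unfolding is_moment_sequence_def fls_bigo_def by blast
  have b1: "fls_nth (E_infinity \<nu> - fls_ratio c d n fls_X_inv) j = 0" if "j < int n + 1" for j
    using assms that unfolding is_moment_sequence_def fls_bigo_def
    by (metis of_nat_1 of_nat_add)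
  show "poly_act (Rpoly c d n) (fls_nth (E_zero \<nu>)) k = poly_act (Qpoly c d n) (fls_nth 1) k"
    if "k < int n"
  proof -
    have "0 = poly_act (Rpoly c d n) (fls_nth (E_zero \<nu> - fls_ratio c d n fls_X)) k"
      unfolding poly_act_def using that b0
      by (intro sum.neutral[symmetric] ballI) (simp del: fls_minus_nth)
    then show ?thesis
      unfolding fls_eval_mult_nth_X[symmetric] ratio[OF nz(1)] by simp
  qed
  show "poly_act (Rpoly c d n) (\<lambda>k. fls_nth (E_infinity \<nu>) (- k)) k =
      poly_act (Qpoly c d n) (fls_nth 1) k" if "k \<ge> 0"
  proof -
    have "0 = poly_act (Rpoly c d n)
        (\<lambda>k. fls_nth (E_infinity \<nu> - fls_ratio c d n fls_X_inv) (- k)) k"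
      unfolding poly_act_def using that b1 degree_Rpoly[of c d n]
      by (intro sum.neutral[symmetric] ballI) (simp del: fls_minus_nth)
    also have "\<dots> = fls_nth (fls_eval (Rpoly c d n) fls_X_inv * E_infinity \<nu>) (- k)
        - fls_nth (fls_eval (Qpoly c d n) fls_X_inv * 1) (- k)"
      unfolding fls_eval_mult_nth_X_inv[symmetric] ratio[OF nz(2)] by simp
    also have "\<dots> = poly_act (Rpoly c d n) (\<lambda>k. fls_nth (E_infinity \<nu>) (- k)) k
        - poly_act (Qpoly c d n) (\<lambda>k. fls_nth 1 (- k)) k"
      unfolding fls_eval_mult_nth_X_inv ..
    \<comment> \<open>The series 1 is invariant under index reflection, so both expansions receive
      the same right-hand side.\<close>
    also have "(\<lambda>k. fls_nth (1 :: complex fls) (- k)) = fls_nth 1"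
      by (rule ext) simp
    finally show ?thesis by (simp only: right_minus_eq eq_commute[of 0])
  qed
qed

text \<open>The ranges of the two Pade equations overlap in 0 <= k < n, where subtraction cancels
  Q_n. The expansions at infinity and at 0 occupy complementary indices, and their difference is the
  whole sequence \<open>\<nu>\<close>, shifted by one.\<close>

lemma moment_orthogonality:
  assumes "is_moment_sequence c d \<nu>" and "1 \<le> k" and "k \<le> int n"
  shows "poly_act (Rpoly c d n) \<nu> k = 0"
proof -
  have "\<nu> (j + 1) = fls_nth (E_infinity \<nu>) (- j) - fls_nth (E_zero \<nu>) j" for j
    by (auto simp: E_infinity_nth E_zero_nth add.commute)
  then have "poly_act (Rpoly c d n) (\<lambda>j. \<nu> (j + 1)) (k - 1) =
      poly_act (Rpoly c d n) (\<lambda>j. fls_nth (E_infinity \<nu>) (- j)) (k - 1)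
      - poly_act (Rpoly c d n) (fls_nth (E_zero \<nu>)) (k - 1)"
    by (simp only: poly_act_diff_right)
  also have "\<dots> = 0"
    using Pade_equations[OF assms(1), of "k - 1" n] assms(2,3) by simp
  finally show ?thesis by (simp add: poly_act_shift)
qed

text \<open>The orthogonality relations are homogeneous; this value fixes the scale.\<close>

lemma moment_sequence_0:
  assumes "is_moment_sequence c d \<nu>"
  shows "(1 + \<i> * c 1) * \<nu> 0 = 2 * d 1"
  using Pade_equations(2)[OF assms, of 0 1] by (simp add: E_infinity_nth)

text \<open>The sequence $-\overline{\nu_{1-k}}$ satisfies the same orthogonality relations, because the
  polynomials \<^const>\<open>Rpoly\<close> are self-reciprocal, and these relations determine $\nu$.\<close>
lemma moment_sequence_reflect:
  assumes "is_moment_sequence c d \<nu>"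
  shows "\<nu> (1 - k) = - cnj (\<nu> k)"
proof -
  define \<nu>' where "\<nu>' = (\<lambda>k. - cnj (\<nu> (1 - k)))"
  define R where "R = Rpoly c d"
  have act: "poly_act (R n) f k = (\<Sum>i\<le>n. coeff (R n) i * f (k - int i))" for n f k
    unfolding R_def by (rule poly_act_bound[OF degree_Rpoly])
  have cnj_R: "j \<le> n \<Longrightarrow> cnj (coeff (R n) j) = coeff (R n) (n - j)" for j n
    unfolding R_def by (rule cnj_coeff_Rpoly)
  have R_0: "coeff (R n) 0 \<noteq> 0" for n
    unfolding R_def by (rule coeff_Rpoly_0)
  have R_n: "coeff (R n) n \<noteq> 0" for n
    using cnj_R[of n n] R_0[of n] by auto
  have orth: "poly_act (R n) \<nu> k = 0" if "1 \<le> k" "k \<le> int n" for n k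
    unfolding R_def by (rule moment_orthogonality[OF assms that])
  \<comment> \<open>Reversing the sum by self-reciprocity sends \<open>k\<close> to n + 1 - k, which
    maps the range 1..n to itself.\<close>
  have orth': "poly_act (R n) \<nu>' k = 0" if "1 \<le> k" "k \<le> int n" for n k
  proof -
    have "poly_act (R n) \<nu>' k = (\<Sum>i\<le>n. coeff (R n) i * \<nu>' (k - int i))"
      by (rule act)
    also have "\<dots> = (\<Sum>i\<le>n. coeff (R n) (n - i) * \<nu>' (k - int (n - i)))"
      by (rule sum.reindex_bij_witness[of _ "\<lambda>i. n - i" "\<lambda>i. n - i"]) auto
    also have "\<dots> = (\<Sum>i\<le>n. - cnj (coeff (R n) i * \<nu> (int n + 1 - k - int i)))"
      by (intro sum.cong) (auto simp: cnj_R \<nu>'_def of_nat_diff algebra_simps)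
    also have "\<dots> = - cnj (poly_act (R n) \<nu> (int n + 1 - k))"
      by (simp add: act sum_negf)
    finally show ?thesis using orth[of "int n + 1 - k" n] that by simp
  qed
  \<comment> \<open>Induction over the windows 1 - n..n. Each enlargement adds the indices -n and n
    + 1. The relations of R_(n+1) at 1 and at n + 1 determine these, each having a single new term
    with a nonzero end coefficient of R_(n+1).\<close>
  have eq: "\<nu>' k = \<nu> k" if "1 - int n \<le> k" "k \<le> int n" "n \<ge> 1" for n k
    using that(3,1,2)
  proof (induction n arbitrary: k rule: nat_induct_at_least)
    case base
    have 1: "(1 + \<i> * c 1) * \<nu> 0 = 2 * d 1"
      by (rule moment_sequence_0[OF assms])
    have 2: "(1 - \<i> * c 1) * \<nu> 1 + (1 + \<i> * c 1) * \<nu> 0 = 0"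
      using orth[of 1 1] by (simp add: R_def)
    have 3: "(1 - \<i> * c 1) * \<nu>' 1 + (1 + \<i> * c 1) * \<nu>' 0 = 0"
      using orth'[of 1 1] by (simp add: R_def)
    have "(1 - \<i> * c 1) * \<nu> 1 = - 2 * d 1"
      using 1 2 by (simp add: add_eq_0_iff2)
    then have "cnj ((1 - \<i> * c 1) * \<nu> 1) = cnj (- 2 * d 1)" by simp
    then have "(1 + \<i> * c 1) * \<nu>' 0 = 2 * d 1"
      unfolding \<nu>'_def by simp
    then have n0: "\<nu>' 0 = \<nu> 0" using 1 one_pm_i_nonzero(2)[of "c 1"] by (metis mult_left_cancel)
    then have "(1 - \<i> * c 1) * \<nu>' 1 = (1 - \<i> * c 1) * \<nu> 1" using 2 3
      by (metis add_right_cancel)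
    then have "\<nu>' 1 = \<nu> 1" using one_pm_i_nonzero(1)[of "c 1"] by (metis mult_left_cancel)
    moreover have "k = 0 \<or> k = 1" using base by force
    ultimately show ?case using n0 by auto
  next
    case (Suc n)
    consider "1 - int n \<le> k \<and> k \<le> int n" | "k = - int n" | "k = int n + 1"
      using Suc.prems by force
    then show ?case
    proof cases
      case 1
      then show ?thesis using Suc.IH by blast
    next
      case 2
      have "0 = poly_act (R (Suc n)) \<nu>' 1 - poly_act (R (Suc n)) \<nu> 1"
        using orth[of 1 "Suc n"] orth'[of 1 "Suc n"] by simp
      also have "\<dots> = (\<Sum>i\<le>Suc n. coeff (R (Suc n)) i * (\<nu>' (1 - int i) - \<nu> (1 - int i)))"
        by (simp only: act sum_subtractf right_diff_distrib)
      also have "\<dots> = (\<Sum>i\<in>{Suc n}. coeff (R (Suc n)) i * (\<nu>' (1 - int i) - \<nu> (1 - int i)))"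
        using Suc.hyps by (intro sum.mono_neutral_right) (auto simp: Suc.IH le_Suc_eq)
      finally show ?thesis using R_n[of "Suc n"] 2 by simp
    next
      case 3
      have "0 = poly_act (R (Suc n)) \<nu>' k - poly_act (R (Suc n)) \<nu> k"
        using orth[of k "Suc n"] orth'[of k "Suc n"] 3 by simp
      also have "\<dots> = (\<Sum>i\<le>Suc n. coeff (R (Suc n)) i * (\<nu>' (k - int i) - \<nu> (k - int i)))"
        by (simp only: act sum_subtractf right_diff_distrib)
      also have "\<dots> = (\<Sum>i\<in>{0}. coeff (R (Suc n)) i * (\<nu>' (k - int i) - \<nu> (k - int i)))"
        using Suc.hyps 3 by (intro sum.mono_neutral_right) (auto simp: Suc.IH)
      finally show ?thesis using R_0[of "Suc n"] by simp
    qed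
  qed
  have "\<nu>' k = \<nu> k"
    by (rule eq[of "nat \<bar>k\<bar> + 1"]) auto
  then have "cnj (\<nu> k) = - \<nu> (1 - k)" by (metis \<nu>'_def complex_cnj_cnj complex_cnj_minus)
  then show ?thesis by simp
qed

text \<open>Partial sums of \<open>\<nu>\<close> give the moments of L for k >= 0 and Hermitian
  symmetry extends them; \<open>moment_sequence_reflect\<close> then makes the differences correct
  for k <= 0 as well.\<close>

lemma trigonometric_moments:
  assumes "is_moment_sequence c d \<nu>"
  obtains m where "m 0 = 1" and "\<And>k. m (- k) = cnj (m k)" and "\<And>k. m k - m (k - 1) = \<nu> k"
proof -
  define f where "f = (\<lambda>n::nat. 1 + (\<Sum>j=1..n. \<nu> (int j)))"
  define m where "m = (\<lambda>k::int. if k \<ge> 0 then f (nat k) else cnj (f (nat (- k))))"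
  have m0: "m 0 = 1" by (simp add: m_def f_def)
  have herm: "m (- k) = cnj (m k)" for k
    by (cases "k = 0") (auto simp: m_def f_def)
  have pos: "m k - m (k - 1) = \<nu> k" if k: "k \<ge> 1" for k
  proof -
    obtain n where n: "k - 1 = int n"
      using k by (meson nonneg_int_cases diff_ge_0_iff_ge)
    then have "nat k = Suc n" "nat (k - 1) = n" "int (Suc n) = k" by simp_all
    with k show ?thesis by (simp add: m_def f_def del: of_nat_Suc)
  qed
  have "m k - m (k - 1) = \<nu> k" for k
  proof (cases "k \<ge> 1")
    case False
    have "m k - m (k - 1) = - cnj (m (1 - k) - m (1 - k - 1))"
      using herm[of "- k"] herm[of "1 - k"] by simp
    also have "\<dots> = - cnj (\<nu> (1 - k))"
      using False by (subst pos) auto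
    also have "\<dots> = \<nu> k"
      by (simp add: moment_sequence_reflect[OF assms])
    finally show ?thesis .
  qed (rule pos)
  with that m0 herm show ?thesis by blast
qed

section \<open>The three-term recurrence of a chain sequence\<close>

text \<open>Since the recurrence starts with \<open>d 2\<close>, the value \<open>d 1\<close> enters
  only through \<open>b\<close>. Up to 2^n, the initial pair (1, 1) gives R_n(1) and (1, 1 -
  \<open>d 1\<close>) gives h_n.\<close>

fun chain_sol :: "(nat \<Rightarrow> real) \<Rightarrow> real \<Rightarrow> real \<Rightarrow> nat \<Rightarrow> real" where
  "chain_sol d a b 0 = a"
| "chain_sol d a b (Suc 0) = b"
| "chain_sol d a b (Suc (Suc n)) = chain_sol d a b (Suc n) - d (n + 2) * chain_sol d a b n"

lemma chain_sol_minus_scaled: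
  "chain_sol d a b n - x * chain_sol d a' b' n = chain_sol d (a - x * a') (b - x * b') n"
  by (induction n rule: induct_nat_012) (simp_all add: algebra_simps)

text \<open>With y_(n+1) = (1 - g_(n+1)) y_n, the subtracted term d_(n+2) y_n equals g_(n+2)
  y_(n+1), so the next step again multiplies by 1 - g_(n+2).\<close>

lemma chain_sol_parameter:
  assumes "parameter_sequence d g"
  shows "chain_sol d (1 - g 0) (1 - d 1 - g 0) n = (\<Prod>j\<le>n. 1 - g j)"
proof (induction n rule: induct_nat_012)
  case 1
  have "d (Suc 0) = (1 - g 0) * g (Suc 0)"
    using assms by (simp add: parameter_sequence_def)
  then show ?case by (simp add: algebra_simps)
next
  case (ge2 n)
  have "d (Suc (Suc n)) = (1 - g (Suc n)) * g (Suc (Suc n))"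
    using assms by (simp add: parameter_sequence_def)
  moreover have "chain_sol d (1 - g 0) (1 - d 1 - g 0) (Suc n) =
      (1 - g (Suc n)) * chain_sol d (1 - g 0) (1 - d 1 - g 0) n"
    unfolding ge2 by simp
  ultimately have "d (Suc (Suc n)) * chain_sol d (1 - g 0) (1 - d 1 - g 0) n =
      g (Suc (Suc n)) * chain_sol d (1 - g 0) (1 - d 1 - g 0) (Suc n)"
    by (simp only: mult_ac)
  then have "chain_sol d (1 - g 0) (1 - d 1 - g 0) (Suc (Suc n)) =
      (1 - g (Suc (Suc n))) * chain_sol d (1 - g 0) (1 - d 1 - g 0) (Suc n)"
    by (simp add: left_diff_distrib)
  then show ?case unfolding ge2 by simp
qed simp

lemma chain_sol_one_pos:
  assumes "parameter_sequence d g"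
  shows "chain_sol d 1 1 n > 0"
proof -
  have g: "0 < g (Suc n)" "g (Suc n) < 1" "d (Suc (Suc n)) = (1 - g (Suc n)) * g (Suc (Suc n))" for n
    using assms by (simp_all add: parameter_sequence_def)
  \<comment> \<open>Positivity alone is not inductive; the lower bound on the quotient of
    consecutive terms is carried along.\<close>
  have "chain_sol d 1 1 n > 0 \<and> chain_sol d 1 1 (Suc n) > (1 - g (Suc n)) * chain_sol d 1 1 n"
  proof (induction n)
    case 0
    show ?case using g(1)[of 0] by simp
  next
    case (Suc n)
    have "chain_sol d 1 1 (Suc n) > 0"
      using Suc g(2)[of n] by (smt (verit) mult_pos_pos)
    moreover have "d (n + 2) * chain_sol d 1 1 n
        = g (Suc (Suc n)) * ((1 - g (Suc n)) * chain_sol d 1 1 n)"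
      by (simp add: g(3))
    moreover have "\<dots> < g (Suc (Suc n)) * chain_sol d 1 1 (Suc n)"
      using Suc g(1)[of "Suc n"] by (intro mult_strict_left_mono) auto
    ultimately show ?case by (simp add: algebra_simps)
  qed
  then show ?thesis ..
qed

definition chain_ratio :: "(nat \<Rightarrow> real) \<Rightarrow> nat \<Rightarrow> real" where
  "chain_ratio d n = chain_sol d 1 (1 - d 1) n / chain_sol d 1 1 n"

text \<open>Subtracting \<open>g 0\<close> times the denominator from the numerator yields exactly
  the solution that \<open>chain_sol_parameter\<close> evaluates as a product of positive
  factors.\<close>

lemma chain_ratio_gt:
  assumes "parameter_sequence d g"
  shows "chain_ratio d n > g 0"
proof -
  have "g j < 1" for j
    using assms by (cases j) (auto simp: parameter_sequence_def)
  then have "chain_sol d 1 (1 - d 1) n - g 0 * chain_sol d 1 1 n > 0"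
    unfolding chain_sol_minus_scaled
    using chain_sol_parameter[OF assms, of n] by (simp add: prod_pos)
  then show ?thesis
    using chain_sol_one_pos[OF assms, of n] by (simp add: chain_ratio_def field_simps)
qed

lemma chain_ratio_decreasing:
  assumes "parameter_sequence d g"
  shows "chain_ratio d (Suc n) < chain_ratio d n"
proof -
  have "g n < 1" for n
    using assms by (cases n) (auto simp: parameter_sequence_def)
  then have d: "d (Suc n) > 0" for n
    using assms by (simp add: parameter_sequence_def)
  \<comment> \<open>The Casoratian of the two solutions starts at \<open>d 1\<close> and is
    multiplied by \<open>d (n + 2)\<close> in each step.\<close>
  have "chain_sol d 1 (1 - d 1) n * chain_sol d 1 1 (Suc n) -
      chain_sol d 1 (1 - d 1) (Suc n) * chain_sol d 1 1 n > 0"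
  proof (induction n)
    case 0
    show ?case using d[of 0] by simp
  next
    case (Suc n)
    then have "d (n + 2) * (chain_sol d 1 (1 - d 1) n * chain_sol d 1 1 (Suc n) -
        chain_sol d 1 (1 - d 1) (Suc n) * chain_sol d 1 1 n) > 0"
      using d[of "Suc n"] by simp
    then show ?case by (simp add: algebra_simps)
  qed
  then show ?thesis
    using chain_sol_one_pos[OF assms, of n] chain_sol_one_pos[OF assms, of "Suc n"]
    by (simp add: chain_ratio_def field_simps)
qed

text \<open>The limit \<open>s\<close> of the ratios is at most $M_0$ because it is the initial value of the parameter
  sequence \<open>1 - y n / y (n - 1)\<close>, where \<open>y\<close> is the solution of the recurrence that is positive for
  the initial value \<open>s\<close>.\<close>
lemma chain_ratio_tendsto:
  assumes "maximal_parameter_sequence d M"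
  shows "chain_ratio d \<longlonglongrightarrow> M 0"
proof -
  have M: "parameter_sequence d M" and max: "\<And>g. parameter_sequence d g \<Longrightarrow> g 0 \<le> M 0"
    using assms by (auto simp: maximal_parameter_sequence_def)
  note b_pos = chain_sol_one_pos[OF M]
  have anti: "decseq (chain_ratio d)"
    using chain_ratio_decreasing[OF M] by (intro decseq_SucI) (simp add: less_imp_le)
  then obtain s where s: "chain_ratio d \<longlonglongrightarrow> s" and lower: "\<And>n. s \<le> chain_ratio d n"
    using decseq_convergent[of "chain_ratio d" "M 0"] chain_ratio_gt[OF M] by (metis less_imp_le)
  have s_M: "M 0 \<le> s"
    using s by (rule LIMSEQ_le_const) (use chain_ratio_gt[OF M] in \<open>auto intro: less_imp_le\<close>)
  have M0: "0 \<le> M 0" "M 0 < 1"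
    using M by (auto simp: parameter_sequence_def)
  \<comment> \<open>Strictness is what makes \<open>y\<close> positive.\<close>
  have s_less: "s < chain_ratio d n" for n
    using lower[of "Suc n"] chain_ratio_decreasing[OF M, of n] by simp
  then have "s < 1" using s_less[of 0] by (simp add: chain_ratio_def)
  define y where "y = chain_sol d (1 - s) (1 - d 1 - s)"
  have y_pos: "y n > 0" for n
  proof -
    have "y n = chain_sol d 1 (1 - d 1) n - s * chain_sol d 1 1 n"
      by (simp add: chain_sol_minus_scaled y_def)
    then show ?thesis
      using s_less[of n] b_pos[of n] by (simp add: chain_ratio_def field_simps)
  qed
  \<comment> \<open>Chosen so that y_n = (1 - g_n) y_(n-1) for n >= 1, the converse of
    \<open>chain_sol_parameter\<close>.\<close>
  define g where "g = (\<lambda>n. if n = 0 then s else 1 - y n / y (n - 1))"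
  have d_pos: "d (Suc n) > 0" for n
    using M by (cases n) (auto simp: parameter_sequence_def)
  have g_Suc: "d (Suc n) = (1 - g n) * g (Suc n)" for n
  proof (cases n)
    case 0
    then show ?thesis using \<open>s < 1\<close> by (simp add: g_def y_def field_simps)
  next
    case (Suc k)
    have y: "y (Suc n) = y n - d (Suc n) * y k" by (simp add: y_def Suc)
    have "(1 - g n) * g (Suc n) = (y n - y (Suc n)) / y k"
      using y_pos[of k] y_pos[of n] by (simp add: g_def Suc diff_divide_distrib right_diff_distrib)
    also have "\<dots> = d (Suc n)"
      using y_pos[of k] by (simp add: y)
    finally show ?thesis ..
  qed
  have g_less: "g n < 1" for n
    using \<open>s < 1\<close> y_pos by (simp add: g_def)
  have g_pos: "g (Suc n) > 0" for n
    using g_Suc[of n] d_pos[of n] g_less[of n] by (metis zero_less_mult_pos diff_gt_0_iff_gt)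
  have "g 0 \<ge> 0" using s_M M0 by (simp add: g_def)
  then have "parameter_sequence d g"
    unfolding parameter_sequence_def
    using g_less g_pos g_Suc by (metis One_nat_def Suc_le_D diff_Suc_1)
  then have "s \<le> M 0" using max[of g] by (simp add: g_def)
  with s s_M show ?thesis by simp
qed

section \<open>Values of R_n at 1 and under the functional\<close>

lemma poly_Rpoly_1: "poly (Rpoly c d n) 1 = of_real (2 ^ n * chain_sol d 1 1 n)"
  by (induction n rule: induct_nat_012) (simp_all add: algebra_simps)

text \<open>Orthogonality to \<open>\<nu>\<close> says that consecutive values agree, so the action
  on \<open>m\<close> is constant on 0..n and only its common value has to be computed.\<close>

lemma poly_act_Rpoly_moments:
  assumes "is_moment_sequence c d \<nu>" and "m 0 = 1" and m: "\<And>k. m k - m (k - 1) = \<nu> k"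
    and "0 \<le> k" and "k \<le> int n"
  shows "poly_act (Rpoly c d n) m k = of_real (2 ^ n * chain_sol d 1 (1 - d 1) n)"
proof -
  have const: "poly_act (Rpoly c d n) m (int k) = poly_act (Rpoly c d n) m 0" if "k \<le> n" for n k
    using that
  proof (induction k)
    case (Suc k)
    have "poly_act (Rpoly c d n) m (int (Suc k)) - poly_act (Rpoly c d n) m (int (Suc k) - 1) =
        poly_act (Rpoly c d n) (\<lambda>k. m k - m (k - 1)) (int (Suc k))"
      unfolding poly_act_diff_right using poly_act_shift[of _ m "-1"] by simp
    also have "\<dots> = 0"
      unfolding m using Suc.prems by (intro moment_orthogonality[OF assms(1)]) auto
    finally show ?case using Suc by simp
  qed simp
  have "poly_act (Rpoly c d n) m 0 = of_real (2 ^ n * chain_sol d 1 (1 - d 1) n)"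
  proof (induction n rule: induct_nat_012)
    case 1
    have "(1 + \<i> * c 1) * (1 - m (- 1)) = 2 * d 1"
      using moment_sequence_0[OF assms(1)] m[of 0] assms(2) by simp
    moreover have "x * (1 - y) = z \<Longrightarrow> x * y = x - z" for x y z :: complex
      by (auto simp: algebra_simps)
    ultimately have "(1 + \<i> * c 1) * m (- 1) = 1 + \<i> * c 1 - 2 * d 1"
      by blast
    then show ?case using assms(2) by simp
  next
    case (ge2 n)
    have alg: "(1 - x) * y + (1 + x) * y - z = 2 * y - z" for x y z :: complex
      by (simp add: algebra_simps)
    \<comment> \<open>At index 1 instead of 0, the recurrence involves only the indices 1 and 0,
      which lie in the ranges of constancy; the terms with \<open>c\<close> then cancel.\<close>
    have "poly_act (Rpoly c d (Suc (Suc n))) m 0 = poly_act (Rpoly c d (Suc (Suc n))) m (int 1)"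
      by (rule const[symmetric]) simp
    also have "\<dots> = (1 - \<i> * c (n + 2)) * poly_act (Rpoly c d (Suc n)) m (int 1)
        + (1 + \<i> * c (n + 2)) * poly_act (Rpoly c d (Suc n)) m 0
        - 4 * of_real (d (n + 2)) * poly_act (Rpoly c d n) m 0"
      unfolding poly_act_Rpoly_Suc_Suc by (simp only: of_nat_1 diff_self)
    also have "poly_act (Rpoly c d (Suc n)) m (int 1) = poly_act (Rpoly c d (Suc n)) m 0"
      by (rule const) simp
    also have "(1 - \<i> * c (n + 2)) * poly_act (Rpoly c d (Suc n)) m 0
        + (1 + \<i> * c (n + 2)) * poly_act (Rpoly c d (Suc n)) m 0
        - 4 * of_real (d (n + 2)) * poly_act (Rpoly c d n) m 0 =
        2 * poly_act (Rpoly c d (Suc n)) m 0 - 4 * of_real (d (n + 2)) * poly_act (Rpoly c d n) m 0"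
      by (rule alg)
    also have "\<dots> = of_real (2 ^ Suc (Suc n) * chain_sol d 1 (1 - d 1) (Suc (Suc n)))"
      unfolding ge2 chain_sol.simps power_Suc by (simp only: of_real_mult of_real_diff
          of_real_numeral right_diff_distrib mult_ac) simp
    finally show ?case .
  qed (use assms(2) in simp)
  moreover have "poly_act (Rpoly c d n) m (int (nat k)) = poly_act (Rpoly c d n) m 0"
    using assms(5) by (intro const) simp
  ultimately show ?thesis
    using assms(4) by (simp only: int_nat_eq if_True)
qed

section \<open>Hermitian Toeplitz forms\<close>

text \<open>If \<open>m k\<close> is the value of a functional at $\zeta^{-k}$, then \<open>toeplitz_form m p q\<close> is its value
  at $p(\zeta) \overline{q}(1/\zeta)$.\<close>
definition toeplitz_form :: "(int \<Rightarrow> complex) \<Rightarrow> complex poly \<Rightarrow> complex poly \<Rightarrow> complex" where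
  "toeplitz_form m p q = (\<Sum>j\<le>degree q. cnj (coeff q j) * poly_act p m (int j))"

lemma toeplitz_form_bound:
  assumes "degree q \<le> n"
  shows "toeplitz_form m p q = (\<Sum>j\<le>n. cnj (coeff q j) * poly_act p m (int j))"
  unfolding toeplitz_form_def using assms
  by (intro sum.mono_neutral_left) (auto simp: coeff_eq_0)

lemma toeplitz_form_add_left: "toeplitz_form m (p + p') q = toeplitz_form m p q + toeplitz_form m p' q"
  by (simp add: toeplitz_form_def distrib_left sum.distrib)

lemma toeplitz_form_smult_left: "toeplitz_form m (smult a p) q = a * toeplitz_form m p q"
  by (simp add: toeplitz_form_def sum_distrib_left mult_ac)

lemma toeplitz_form_add_right: "toeplitz_form m p (q + q') = toeplitz_form m p q + toeplitz_form m p q'"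
proof -
  define n where "n = max (degree q) (degree q')"
  have "degree (q + q') \<le> n" "degree q \<le> n" "degree q' \<le> n"
    by (auto simp: n_def degree_add_le_max)
  then show ?thesis
    by (simp add: toeplitz_form_bound[of _ n] distrib_right sum.distrib)
qed

lemma toeplitz_form_smult_right: "toeplitz_form m p (smult a q) = cnj a * toeplitz_form m p q"
  by (simp add: toeplitz_form_bound[of "smult a q" "degree q"] toeplitz_form_bound[of q "degree q"]
      sum_distrib_left mult_ac)

lemma toeplitz_form_double_sum:
  assumes "degree p \<le> n" and "degree q \<le> n"
  shows "toeplitz_form m p q =
    (\<Sum>j\<le>n. \<Sum>i\<le>n. cnj (coeff q j) * coeff p i * m (int j - int i))"
  unfolding toeplitz_form_bound[OF assms(2)] poly_act_bound[OF assms(1)]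
  by (simp add: sum_distrib_left mult_ac)

lemma toeplitz_form_hermitian:
  assumes "\<And>k. m (- k) = cnj (m k)"
  shows "cnj (toeplitz_form m p q) = toeplitz_form m q p"
proof -
  define n where "n = max (degree p) (degree q)"
  have le: "degree p \<le> n" "degree q \<le> n"
    by (auto simp: n_def)
  have m: "cnj (m (int j - int i)) = m (int i - int j)" for i j
    using assms[of "int j - int i"] by simp
  have "cnj (toeplitz_form m p q) =
      (\<Sum>j\<le>n. \<Sum>i\<le>n. cnj (coeff p i) * coeff q j * m (int i - int j))"
    unfolding toeplitz_form_double_sum[OF le] by (simp add: m mult_ac)
  also have "\<dots> = toeplitz_form m q p"
    unfolding toeplitz_form_double_sum[OF le(2,1)] by (rule sum.swap)
  finally show ?thesis .
qed

lemma poly_1_eq_sum: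
  fixes p :: "'a::comm_semiring_1 poly"
  assumes "degree p \<le> n"
  shows "poly p 1 = (\<Sum>j\<le>n. coeff p j)"
proof -
  have "poly p 1 = (\<Sum>j\<le>degree p. coeff p j)"
    by (simp add: poly_altdef)
  also have "\<dots> = (\<Sum>j\<le>n. coeff p j)"
    using assms by (intro sum.mono_neutral_left) (auto simp: coeff_eq_0)
  finally show ?thesis .
qed

text \<open>The polynomials \<open>u n\<close> are the reproducing kernels at the point 1, normalised to the value 1
  there.\<close>
locale point_kernels =
  fixes m :: "int \<Rightarrow> complex" and u :: "nat \<Rightarrow> complex poly" and s :: "nat \<Rightarrow> real"
  assumes hermitian: "m (- k) = cnj (m k)"
    and degree_u: "degree (u n) = n"
    and poly_u_1: "poly (u n) 1 = 1"
    and act_u: "\<lbrakk>0 \<le> k; k \<le> int n\<rbrakk> \<Longrightarrow> poly_act (u n) m k = s n"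
    and s_pos: "s n > 0"
    and s_Suc_less: "s (Suc n) < s n"
begin

text \<open>As the action of \<open>u n\<close> is constant on 0..n, the form reduces to the sum of
  the conjugated coefficients of \<open>q\<close>.\<close>

lemma form_u:
  assumes "degree q \<le> n"
  shows "toeplitz_form m (u n) q = s n * cnj (poly q 1)"
proof -
  have "toeplitz_form m (u n) q = (\<Sum>j\<le>n. cnj (coeff q j) * s n)"
    unfolding toeplitz_form_bound[OF assms] by (intro sum.cong) (auto simp: act_u)
  then show ?thesis
    unfolding poly_1_eq_sum[OF assms] by (simp add: sum_distrib_left mult.commute)
qed

lemma u_0: "u 0 = 1"
proof -
  obtain a where "u 0 = [:a:]" using degree_u[of 0] by (rule degree_eq_zeroE)
  with poly_u_1[of 0] show ?thesis by (simp add: one_pCons)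
qed

text \<open>Induction on the degree, removing the top coefficient with a multiple of
  \<open>u (Suc n)\<close>. Reality, lower bound and definiteness are proved together because the
  step for each uses the others.\<close>

lemma form_nonneg_aux:
  assumes "degree p \<le> n"
  shows "\<exists>r. toeplitz_form m p p = of_real r \<and> s n * (cmod (poly p 1))\<^sup>2 \<le> r \<and> (r = 0 \<longrightarrow> p = 0)"
  using assms
proof (induction n arbitrary: p)
  case 0
  then obtain a where p: "p = [:a:]" by (metis degree_eq_zeroE le_zero_eq)
  have "p = smult a (u 0)" by (simp add: p u_0)
  then have "toeplitz_form m p p = a * cnj a * s 0"
    using form_u[of "u 0" 0]
    by (simp add: toeplitz_form_smult_left toeplitz_form_smult_right degree_u poly_u_1)
  then have "toeplitz_form m p p = of_real (s 0 * (cmod a)\<^sup>2)"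
    by (simp add: complex_norm_square[symmetric] mult.commute)
  then show ?case
    using s_pos[of 0] by (intro exI[of _ "s 0 * (cmod a)\<^sup>2"]) (simp add: p)
next
  case (Suc n)
  define x where "x = coeff p (Suc n) / coeff (u (Suc n)) (Suc n)"
  define q where "q = p - smult x (u (Suc n))"
  have lead: "coeff (u (Suc n)) (Suc n) \<noteq> 0"
    using degree_u[of "Suc n"] by (metis degree_0 leading_coeff_neq_0 nat.distinct(1))
  have "degree q \<le> Suc n"
    unfolding q_def using Suc.prems by (intro degree_diff_le) (auto simp: degree_u)
  moreover have "coeff q (Suc n) = 0"
    using lead by (simp add: q_def x_def)
  ultimately have deg: "degree q \<le> n"
    by (metis degree_0 eq_zero_or_degree_less le_neq_implies_less less_Suc_eq_le zero_le)
  have p: "p = q + smult x (u (Suc n))" by (simp add: q_def)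
  define y where "y = poly q 1"
  have p1: "poly p 1 = y + x" by (simp add: p y_def poly_u_1)
  obtain r where r: "toeplitz_form m q q = of_real r" "s n * (cmod y)\<^sup>2 \<le> r" "r = 0 \<longrightarrow> q = 0"
    using Suc.IH[OF deg] y_def by blast
  have uq: "toeplitz_form m (u (Suc n)) q = s (Suc n) * cnj y"
    using deg by (simp add: form_u y_def)
  have qu: "toeplitz_form m q (u (Suc n)) = s (Suc n) * y"
    using toeplitz_form_hermitian[of m "u (Suc n)" q] hermitian uq by simp
  have uu: "toeplitz_form m (u (Suc n)) (u (Suc n)) = s (Suc n)"
    by (simp add: form_u degree_u poly_u_1)
  \<comment> \<open>By \<open>form_u\<close>, all terms involving \<open>u (Suc n)\<close> share the
    factor s_(n+1), and they complete the square |y + x|^2 - |y|^2.\<close>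
  have "toeplitz_form m p p =
      of_real r + s (Suc n) * ((y + x) * cnj (y + x) - y * cnj y)"
    unfolding p toeplitz_form_add_left toeplitz_form_add_right toeplitz_form_smult_left
      toeplitz_form_smult_right uq qu uu r(1) by (simp add: algebra_simps)
  then have form: "toeplitz_form m p p =
      of_real (r + s (Suc n) * ((cmod (y + x))\<^sup>2 - (cmod y)\<^sup>2))" (is "_ = of_real ?r")
    by (simp add: complex_norm_square[symmetric] del: complex_cnj_add)
  have le: "s (Suc n) * (cmod y)\<^sup>2 \<le> s n * (cmod y)\<^sup>2"
    using s_Suc_less[of n] by (intro mult_right_mono) auto
  \<comment> \<open>Vanishing forces equality in every estimate; since s_(n+1) < s_n, this gives y =
    0 and then x = 0, so r = 0 and q = 0.\<close>
  have "p = 0" if "?r = 0"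
  proof -
    have "s (Suc n) * (cmod (y + x))\<^sup>2 \<ge> 0" using s_pos[of "Suc n"] by simp
    moreover have "r + (s (Suc n) * (cmod (y + x))\<^sup>2 - s (Suc n) * (cmod y)\<^sup>2) = 0"
      using that by (simp only: right_diff_distrib)
    ultimately have "s n * (cmod y)\<^sup>2 \<le> s (Suc n) * (cmod y)\<^sup>2"
        and "s (Suc n) * (cmod (y + x))\<^sup>2 = 0"
      using r(2) le by linarith+
    then have "y = 0" "y + x = 0"
      using s_Suc_less[of n] s_pos[of "Suc n"] by (simp_all only: mult_le_cancel_right
          mult_eq_0_iff power_eq_0_iff norm_eq_zero) auto
    then show ?thesis using that r(3) p by simp
  qed
  then show ?case
    using r(2) le by (intro exI[of _ ?r] conjI form) (simp_all add: p1 right_diff_distrib)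
qed

lemma form_ge: "degree p \<le> n \<Longrightarrow> s n * (cmod (poly p 1))\<^sup>2 \<le> Re (toeplitz_form m p p)"
  using form_nonneg_aux[of p n] by auto

lemma form_pos: "p \<noteq> 0 \<Longrightarrow> Re (toeplitz_form m p p) \<noteq> 0"
  using form_nonneg_aux[OF order_refl, of p] by auto

end

section \<open>The trigonometric moment problem\<close>

lemma discrete_real_distribution:
  fixes a \<theta> :: "nat \<Rightarrow> real"
  assumes nonneg: "\<And>l. l < n \<Longrightarrow> 0 \<le> a l" and sum: "(\<Sum>l<n. a l) = 1"
  obtains P where "real_distribution P"
    and "\<And>f :: real \<Rightarrow> complex. f \<in> borel_measurable borel \<Longrightarrow>
      (LINT x|P. f x) = (\<Sum>l<n. a l * f (\<theta> l))"
    and "\<And>A. A \<in> sets borel \<Longrightarrow> (\<And>l. l < n \<Longrightarrow> \<theta> l \<in> A) \<Longrightarrow> measure P A = 1"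
proof -
  define w where "w = (\<lambda>l. if l < n then a l else 0)"
  have w: "w l \<ge> 0" for l using nonneg by (simp add: w_def)
  have "(\<integral>\<^sup>+l. ennreal (w l) \<partial>count_space UNIV) = (\<Sum>l<n. ennreal (w l))"
    by (rule nn_integral_count_space') (auto simp: w_def)
  also have "\<dots> = ennreal (\<Sum>l<n. w l)"
    using w by (intro sum_ennreal) auto
  finally have total: "(\<integral>\<^sup>+l. ennreal (w l) \<partial>count_space UNIV) = 1"
    using sum by (simp add: w_def)
  define p where "p = embed_pmf w"
  have pmf: "pmf p l = w l" for l
    unfolding p_def by (rule pmf_embed_pmf[OF w total])
  have set: "set_pmf p \<subseteq> {..<n}"
    by (auto simp: set_pmf_eq pmf w_def split: if_splits)
  define P where "P = distr (measure_pmf p) borel \<theta>"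
  have "real_distribution P"
    unfolding P_def by (rule prob_space.real_distribution_distr[OF prob_space_measure_pmf]) simp
  moreover have "(LINT x|P. f x) = (\<Sum>l<n. a l * f (\<theta> l))"
    if "f \<in> borel_measurable borel" for f :: "real \<Rightarrow> complex"
  proof -
    have "(LINT x|P. f x) = (LINT l|p. f (\<theta> l))"
      unfolding P_def using that by (intro integral_distr) auto
    also have "\<dots> = (\<Sum>l<n. pmf p l *\<^sub>R f (\<theta> l))"
      using set by (intro integral_measure_pmf) auto
    finally show ?thesis by (simp add: pmf w_def scaleR_conv_of_real)
  qed
  moreover have "measure P A = 1" if "A \<in> sets borel" "\<And>l. l < n \<Longrightarrow> \<theta> l \<in> A" for A
  proof -
    have "measure P A = measure p (\<theta> -` A)"
      unfolding P_def using that(1) by (subst measure_distr) auto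
    also have "\<dots> = 1"
      using set that(2) by (intro measure_pmf.prob_eq_1[THEN iffD2]) (auto simp: AE_measure_pmf_iff)
    finally show ?thesis .
  qed
  ultimately show ?thesis by (rule that)
qed

text \<open>A geometric sum; the bound on \<open>t\<close> excludes nonzero multiples of
  \<open>K\<close>.\<close>

lemma sum_cis_roots_of_unity:
  fixes t :: int
  assumes "\<bar>t\<bar> < int K"
  shows "(\<Sum>l<K. cis (of_int t * (2 * pi * real l / real K))) = (if t = 0 then of_nat K else 0)"
proof (cases "t = 0")
  case False
  have K: "real K > 0" using assms by auto
  define z where "z = cis (2 * pi * of_int t / real K)"
  have pow: "cis (of_int t * (2 * pi * real l / real K)) = z ^ l" for l
    unfolding z_def Complex.DeMoivre by (rule arg_cong[of _ _ cis]) simp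
  have "z ^ K = 1"
    using K cis_multiple_2pi[of "of_int t"] by (simp add: z_def Complex.DeMoivre)
  moreover have "z \<noteq> 1"
  proof
    assume "z = 1"
    then have "cos (2 * pi * of_int t / real K) = 1"
      by (metis z_def cis.sel(1) one_complex.sel(1))
    then obtain n where "2 * pi * of_int t / real K = of_int n * 2 * pi"
      using cos_one_2pi_int by blast
    then have "of_int t = of_int n * real K"
      using K by (simp add: field_simps)
    then have "t = n * int K"
      by (metis of_int_eq_iff of_int_mult of_int_of_nat_eq)
    with False assms show False
      by (cases "n = 0") (auto simp: abs_mult mult_less_cancel_right1)
  qed
  ultimately show ?thesis
    unfolding pow using False geometric_sum[of z K] by simp
qed simp

text \<open>This makes the Fejer sum at x a value of the quadratic form, hence nonnegative.\<close>

lemma toeplitz_form_exponential: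
  "toeplitz_form m (\<Sum>i\<le>n. monom (cis (- (real i * x))) i) (\<Sum>i\<le>n. monom (cis (- (real i * x))) i) =
     (\<Sum>j\<le>n. \<Sum>i\<le>n. m (int j - int i) * cis (of_int (int j - int i) * x))"
proof -
  let ?p = "\<Sum>i\<le>n. monom (cis (- (real i * x))) i"
  have deg: "degree ?p \<le> n"
    by (intro degree_sum_le) (auto intro: order_trans[OF degree_monom_le])
  have "coeff ?p i = cis (- (real i * x))" if "i \<le> n" for i
    using that by (simp add: coeff_sum)
  then show ?thesis
    unfolding toeplitz_form_double_sum[OF deg deg]
    by (intro sum.cong refl) (simp add: cis_cnj cis_mult algebra_simps)
qed

text \<open>The weights are values of the Fejer means of the Fourier series with coefficients \<open>m\<close>.\<close>
lemma fejer_approximation: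
  assumes m_0: "m 0 = 1" and herm: "\<And>k. m (- k) = cnj (m k)"
    and nonneg: "\<And>p. Re (toeplitz_form m p p) \<ge> 0"
  obtains P where "real_distribution P" and "measure P {-1<..2 * pi} = 1"
    and "\<And>k. k \<le> n \<Longrightarrow>
      (LINT x|P. cis (- (real k * x))) = of_real (1 - real k / real (Suc n)) * m (int k)"
proof -
  \<comment> \<open>The frequencies j - i - k have modulus at most 2n < K, so sampling at K nodes
    computes the Fourier coefficients exactly.\<close>
  define K where "K = 2 * Suc n"
  define \<theta> where "\<theta> = (\<lambda>l. 2 * pi * real l / real K)"
  define p where "p = (\<lambda>l. \<Sum>i\<le>n. monom (cis (- (real i * \<theta> l))) i)"
  define a where "a = (\<lambda>l. Re (toeplitz_form m (p l) (p l)) / (real K * real (Suc n)))"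
  have K: "K > 0" by (simp add: K_def)
  have a: "of_real (a l) = (\<Sum>j\<le>n. \<Sum>i\<le>n. m (int j - int i) * cis (of_int (int j - int i) * \<theta> l))
      / (of_nat K * of_nat (Suc n))" for l
  proof -
    have "of_real (Re (toeplitz_form m (p l) (p l))) = toeplitz_form m (p l) (p l)"
      using toeplitz_form_hermitian[of m "p l" "p l"] herm
      by (metis Reals_cnj_iff of_real_Re)
    then show ?thesis
      unfolding a_def p_def toeplitz_form_exponential by simp
  qed
  have moment: "(\<Sum>l<K. of_real (a l) * cis (- (real k * \<theta> l))) =
      of_real (1 - real k / real (Suc n)) * m (int k)" if "k \<le> n" for k
  proof -
    have "(\<Sum>l<K. of_real (a l) * cis (- (real k * \<theta> l))) =
        (\<Sum>l<K. \<Sum>j\<le>n. \<Sum>i\<le>n. m (int j - int i) * cis (of_int (int j - int i - int k) * \<theta> l))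
          / (of_nat K * of_nat (Suc n))"
      unfolding a sum_divide_distrib sum_distrib_right
      by (intro sum.cong refl) (simp add: cis_mult algebra_simps)
    also have "(\<Sum>l<K. \<Sum>j\<le>n. \<Sum>i\<le>n. m (int j - int i) * cis (of_int (int j - int i - int k) * \<theta> l)) =
        (\<Sum>j\<le>n. \<Sum>i\<le>n. m (int j - int i) * (\<Sum>l<K. cis (of_int (int j - int i - int k) * \<theta> l)))"
      unfolding sum_distrib_left by (rule trans[OF sum.swap sum.cong[OF refl sum.swap]])
    also have "\<dots> =
        (\<Sum>i\<le>n. \<Sum>j\<le>n. m (int j - int i) * (\<Sum>l<K. cis (of_int (int j - int i - int k) * \<theta> l)))"
      by (rule sum.swap)
    also have "\<dots> = (\<Sum>i\<le>n. \<Sum>j\<le>n. if j = i + k then m (int k) * of_nat K else 0)"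
    proof (intro sum.cong refl)
      fix i j assume "i \<in> {..n}" "j \<in> {..n}"
      then have "\<bar>int j - int i - int k\<bar> < int K" using that by (auto simp: K_def)
      then show "m (int j - int i) * (\<Sum>l<K. cis (of_int (int j - int i - int k) * \<theta> l)) =
          (if j = i + k then m (int k) * of_nat K else 0)"
        unfolding \<theta>_def by (subst sum_cis_roots_of_unity) auto
    qed
    \<comment> \<open>The number of pairs j = i + k is n + 1 - k, which is the source of the Fejer
      factor.\<close>
    also have "\<dots> = (\<Sum>i\<le>n. if i + k \<le> n then m (int k) * of_nat K else 0)"
      by (intro sum.cong refl) (simp add: sum.delta)
    also have "\<dots> = (\<Sum>i\<in>{..n - k}. m (int k) * of_nat K)"
      using that by (intro sum.mono_neutral_cong_right) auto
    also have "\<dots> = of_real (real (Suc n) - real k) * m (int k) * of_nat K"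
      using that by (simp add: of_nat_diff)
    finally have "(\<Sum>l<K. of_real (a l) * cis (- (real k * \<theta> l))) =
      of_real (real (Suc n) - real k) * m (int k) * of_nat K / (of_nat K * of_nat (Suc n))" .
    moreover have "1 - real k / real (Suc n) = (real (Suc n) - real k) / real (Suc n)"
      by (simp add: diff_divide_distrib del: of_nat_Suc)
    ultimately show ?thesis using K by (simp del: of_nat_Suc)
  qed
  have nonneg_a: "0 \<le> a l" for l
    unfolding a_def using nonneg by simp
  have "complex_of_real (\<Sum>l<K. a l) = 1"
    using moment[of 0] m_0 by simp
  then have sum: "(\<Sum>l<K. a l) = 1"
    using of_real_eq_1_iff by blast
  obtain P where P: "real_distribution P"
    and integral: "\<And>f :: real \<Rightarrow> complex. f \<in> borel_measurable borel \<Longrightarrow>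
      (LINT x|P. f x) = (\<Sum>l<K. a l * f (\<theta> l))"
    and measure: "\<And>A. A \<in> sets borel \<Longrightarrow> (\<And>l. l < K \<Longrightarrow> \<theta> l \<in> A) \<Longrightarrow> measure P A = 1"
    by (rule discrete_real_distribution[of K a \<theta>, OF nonneg_a sum]) (rule that, blast+)
  \<comment> \<open>The interval has the half-open form used in \<open>tight\<close>; its left end
    lies below the node 0.\<close>
  have "measure P {-1<..2 * pi} = 1"
  proof (rule measure)
    show "\<theta> l \<in> {-1<..2 * pi}" if "l < K" for l
    proof -
      have "0 \<le> \<theta> l" by (simp add: \<theta>_def)
      moreover have "\<theta> l \<le> 2 * pi" using that by (simp add: \<theta>_def field_simps)
      ultimately show ?thesis by simp
    qed
  qed simp
  moreover have "(LINT x|P. cis (- (real k * x))) = of_real (1 - real k / real (Suc n)) * m (int k)"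
    if "k \<le> n" for k
    using that by (subst integral)
      (auto simp: moment intro!: borel_measurable_continuous_onI continuous_intros)
  ultimately show ?thesis using P that by blast
qed

text \<open>The Fejer measures share a bounded interval, so they are tight and have a weak limit
  point on the line. Its Fourier coefficients are \<open>m\<close>, as the Fejer factors tend to 1,
  and \<open>cis\<close> carries it to the circle.\<close>

lemma trigonometric_moment_problem:
  assumes m_0: "m 0 = 1" and herm: "\<And>k. m (- k) = cnj (m k)"
    and nonneg: "\<And>p. Re (toeplitz_form m p p) \<ge> 0"
  obtains \<mu> :: "complex measure" where "prob_space \<mu>"
    and "sets \<mu> = sets (restrict_space borel unit_circle)"
    and "\<And>k. (LINT \<zeta>|\<mu>. \<zeta> powi (- k)) = m k"
proof -
  have "\<exists>P. real_distribution P \<and> measure P {-1<..2 * pi} = 1 \<and> (\<forall>k\<le>n.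
      (LINT x|P. cis (- (real k * x))) = of_real (1 - real k / real (Suc n)) * m (int k))" for n
    using fejer_approximation[of m n] assms by metis
  then obtain P where P: "\<And>n. real_distribution (P n)" "\<And>n. measure (P n) {-1<..2 * pi} = 1"
    and moment: "\<And>n k. k \<le> n \<Longrightarrow>
      (LINT x|P n. cis (- (real k * x))) = of_real (1 - real k / real (Suc n)) * m (int k)"
    by metis
  have "-1 < 2 * pi" using pi_gt_zero by linarith
  with P have "tight P"
    unfolding tight_def by (intro conjI allI impI exI[of _ "-1"] exI[of _ "2 * pi"]) auto
  then obtain r M where r: "strict_mono r" and M: "real_distribution M"
    and weak: "weak_conv_m (P \<circ> id \<circ> r) M"
    using tight_imp_convergent_subsubsequence[of P id] by (auto simp: strict_mono_id)
  interpret M: real_distribution M by (rule M)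
  have nonneg_moment: "(LINT x|M. cis (- (real k * x))) = m (int k)" for k
  proof (rule LIMSEQ_unique)
    have "continuous_on UNIV (\<lambda>x. cis (- (real k * x)))"
      by (intro continuous_intros)
    then show "(\<lambda>n. LINT x|P (r n). cis (- (real k * x))) \<longlonglongrightarrow> (LINT x|M. cis (- (real k * x)))"
      using weak_conv_imp_integral_bdd_continuous_conv[of "\<lambda>n. P (r n)" M "\<lambda>x. cis (- (real k * x))" 1]
        P M weak by (simp add: comp_def continuous_on_eq_continuous_at)
    have "(\<lambda>n. 1 - real k / real (Suc n)) \<longlonglongrightarrow> 1 - 0"
      by (intro tendsto_diff tendsto_const LIMSEQ_Suc[OF lim_const_over_n])
    then have "(\<lambda>n. of_real (1 - real k / real (Suc n)) * m (int k)) \<longlonglongrightarrow> of_real (1 - 0) * m (int k)"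
      by (intro tendsto_mult tendsto_of_real tendsto_const)
    then have "(\<lambda>n. of_real (1 - real k / real (Suc (r n))) * m (int k)) \<longlonglongrightarrow> m (int k)"
      using LIMSEQ_subseq_LIMSEQ[OF _ r] by (fastforce simp: comp_def)
    moreover have "eventually (\<lambda>n. of_real (1 - real k / real (Suc (r n))) * m (int k) =
        (LINT x|P (r n). cis (- (real k * x)))) sequentially"
      using eventually_ge_at_top[of k]
      by eventually_elim (use seq_suble[OF r] moment in \<open>metis order_trans\<close>)
    ultimately show "(\<lambda>n. LINT x|P (r n). cis (- (real k * x))) \<longlonglongrightarrow> m (int k)"
      by (rule Lim_transform_eventually)
  qed
  have moment_M: "(LINT x|M. cis (- (of_int k * x))) = m k" for k
  proof (cases "k \<ge> 0")
    case True
    then show ?thesis using nonneg_moment[of "nat k"] by simp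
  next
    case False
    have "(LINT x|M. cis (- (of_int k * x))) = (LINT x|M. cnj (cis (- (real (nat (- k)) * x))))"
      using False by (simp add: cis_cnj)
    also have "\<dots> = cnj (LINT x|M. cis (- (real (nat (- k)) * x)))"
      by simp
    also have "\<dots> = m k"
      unfolding nonneg_moment using False herm[of "- k"] by simp
    finally show ?thesis .
  qed
  define \<mu> where "\<mu> = distr M (restrict_space borel unit_circle) cis"
  have cis: "cis \<in> measurable M (restrict_space borel unit_circle)"
  proof (rule measurable_restrict_space2)
    have "cis \<in> borel_measurable borel"
      by (intro borel_measurable_continuous_onI continuous_intros)
    then show "cis \<in> borel_measurable M"
      by (simp add: measurable_cong_sets[OF M.events_eq_borel refl])
  qed auto
  have "prob_space \<mu>"
    unfolding \<mu>_def using cis by (rule M.prob_space_distr)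
  moreover have "sets \<mu> = sets (restrict_space borel unit_circle)"
    by (simp add: \<mu>_def)
  moreover have "(LINT \<zeta>|\<mu>. \<zeta> powi (- k)) = m k" for k
  proof -
    have "(\<lambda>\<zeta>. \<zeta> powi (- k)) \<in> borel_measurable (restrict_space borel unit_circle)"
      by (intro borel_measurable_continuous_on_restrict continuous_intros) auto
    then have "(LINT \<zeta>|\<mu>. \<zeta> powi (- k)) = (LINT x|M. cis x powi (- k))"
      unfolding \<mu>_def by (rule integral_distr[OF cis])
    then show ?thesis by (simp add: cis_power_int moment_M)
  qed
  ultimately show ?thesis by (rule that)
qed

section \<open>Measures on the circle: support, quadratic form, mass at 1\<close>

lemma null_complement_measure_support:
  fixes \<mu> :: "'a::second_countable_topology measure"
  assumes sets: "sets \<mu> = sets (restrict_space borel A)"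
  shows "space \<mu> - measure_support \<mu> \<in> null_sets \<mu>"
proof -
  have space: "space \<mu> = A"
    using sets_eq_imp_space_eq[OF sets] by (simp add: space_restrict_space)
  define F where "F = {U. open U \<and> emeasure \<mu> (U \<inter> space \<mu>) = 0}"
  \<comment> \<open>The union of all open null sets may be uncountable; Lindelof reduces it to a
    countable one.\<close>
  obtain F' where F': "F' \<subseteq> F" "countable F'" "\<Union>F' = \<Union>F"
    using Lindelof[of F] by (auto simp: F_def)
  have "(\<Union>U\<in>F'. U \<inter> space \<mu>) \<in> null_sets \<mu>"
  proof (rule null_sets_UN'[OF F'(2)])
    fix U assume "U \<in> F'"
    then have U: "open U" "emeasure \<mu> (U \<inter> space \<mu>) = 0"
      using F'(1) by (auto simp: F_def)
    moreover have "U \<inter> space \<mu> \<in> sets \<mu>"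
      unfolding sets space using U(1) by (auto simp: sets_restrict_space)
    ultimately show "U \<inter> space \<mu> \<in> null_sets \<mu>" by auto
  qed
  moreover have "(\<Union>U\<in>F'. U \<inter> space \<mu>) = space \<mu> - measure_support \<mu>"
  proof -
    have "(\<Union>U\<in>F'. U \<inter> space \<mu>) = \<Union>F \<inter> space \<mu>"
      using F'(3) by auto
    also have "\<dots> = space \<mu> - measure_support \<mu>"
      by (auto simp: F_def measure_support_def zero_less_iff_neq_zero)
    finally show ?thesis .
  qed
  ultimately show ?thesis by simp
qed

locale circle_moments = prob_space \<mu> for \<mu> :: "complex measure" +
  fixes m :: "int \<Rightarrow> complex"
  assumes sets_circle: "sets \<mu> = sets (restrict_space borel unit_circle)"
    and moments: "(LINT \<zeta>|\<mu>. \<zeta> powi (- k)) = m k"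
begin

lemma space_circle: "space \<mu> = unit_circle"
  using sets_eq_imp_space_eq[OF sets_circle] by (simp add: space_restrict_space)

lemma measurable_circle:
  fixes f :: "complex \<Rightarrow> 'b::topological_space"
  assumes "continuous_on unit_circle f"
  shows "f \<in> borel_measurable \<mu>"
  using borel_measurable_continuous_on_restrict[OF assms]
  by (simp add: measurable_cong_sets[OF sets_circle refl])

lemma integrable_circle:
  fixes f :: "complex \<Rightarrow> 'b::{banach, second_countable_topology}"
  assumes "continuous_on unit_circle f"
  shows "integrable \<mu> f"
proof -
  have "bounded (f ` unit_circle)"
    using assms by (intro compact_imp_bounded compact_continuous_image) auto
  then obtain B where "\<And>z. z \<in> unit_circle \<Longrightarrow> norm (f z) \<le> B"
    unfolding bounded_iff by blast
  then show ?thesis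
    by (intro integrable_const_bound[where B = B] measurable_circle assms AE_I2)
       (simp add: space_circle)
qed

text \<open>On the circle conjugation is inversion, so the integrand is a Laurent polynomial and its
  integral a combination of moments.\<close>

lemma integral_poly_cnj_poly:
  "(LINT \<zeta>|\<mu>. poly p \<zeta> * cnj (poly q \<zeta>)) = toeplitz_form m p q"
proof -
  define n where "n = max (degree p) (degree q)"
  have le: "degree p \<le> n" "degree q \<le> n"
    by (auto simp: n_def)
  have poly: "poly r z = (\<Sum>i\<le>n. coeff r i * z ^ i)" if "degree r \<le> n" for r and z :: complex
    unfolding poly_altdef using that by (intro sum.mono_neutral_left) (auto simp: coeff_eq_0)
  have "(LINT \<zeta>|\<mu>. poly p \<zeta> * cnj (poly q \<zeta>)) =
      (LINT \<zeta>|\<mu>. (\<Sum>j\<le>n. \<Sum>i\<le>n. cnj (coeff q j) * coeff p i * \<zeta> powi (- (int j - int i))))"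
  proof (rule Bochner_Integration.integral_cong[OF refl])
    fix \<zeta> assume "\<zeta> \<in> space \<mu>"
    then have \<zeta>: "norm \<zeta> = 1" by (simp add: space_circle)
    then have "\<zeta> * cnj \<zeta> = 1" by (simp add: complex_norm_square[symmetric])
    then have cnj: "cnj \<zeta> = inverse \<zeta>" by (simp add: inverse_unique)
    have nz: "\<zeta> \<noteq> 0" using \<zeta> by auto
    have powi: "\<zeta> powi (- (int j - int i)) = \<zeta> ^ i * cnj \<zeta> ^ j" for i j
      using nz by (simp add: power_int_diff cnj power_inverse divide_inverse)
    show "poly p \<zeta> * cnj (poly q \<zeta>) =
        (\<Sum>j\<le>n. \<Sum>i\<le>n. cnj (coeff q j) * coeff p i * \<zeta> powi (- (int j - int i)))"
      unfolding powi poly[OF le(1)] poly[OF le(2)]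
      by (simp add: sum_product mult_ac) (rule sum.swap)
  qed
  also have "\<dots> = (\<Sum>j\<le>n. \<Sum>i\<le>n. cnj (coeff q j) * coeff p i * (LINT \<zeta>|\<mu>. \<zeta> powi (- (int j - int i))))"
  proof -
    have int: "integrable \<mu> (\<lambda>\<zeta>. a * \<zeta> powi k)" for a k
      by (intro integrable_circle continuous_intros) auto
    show ?thesis
      by (simp only: Bochner_Integration.integral_sum Bochner_Integration.integrable_sum int
          Bochner_Integration.integral_mult_right_zero)
  qed
  also have "\<dots> = toeplitz_form m p q"
    unfolding moments by (rule toeplitz_form_double_sum[OF le, symmetric])
  finally show ?thesis .
qed

lemma integral_norm_poly_sq: "(LINT \<zeta>|\<mu>. (cmod (poly p \<zeta>))\<^sup>2) = Re (toeplitz_form m p p)"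
proof -
  have "complex_of_real (LINT \<zeta>|\<mu>. (cmod (poly p \<zeta>))\<^sup>2) =
      (LINT \<zeta>|\<mu>. complex_of_real ((cmod (poly p \<zeta>))\<^sup>2))"
    by (rule integral_complex_of_real[symmetric])
  also have "\<dots> = toeplitz_form m p p"
    unfolding complex_norm_square by (rule integral_poly_cnj_poly)
  finally show ?thesis by (metis Re_complex_of_real)
qed

text \<open>A finite support would be the zero set of a nonzero polynomial, whose squared modulus
  would then have integral 0.\<close>

lemma infinite_measure_support:
  assumes "\<And>p. p \<noteq> 0 \<Longrightarrow> Re (toeplitz_form m p p) \<noteq> 0"
  shows "infinite (measure_support \<mu>)"
proof
  assume fin: "finite (measure_support \<mu>)"
  define p where "p = (\<Prod>a\<in>measure_support \<mu>. [:- a, 1:])"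
  have zero: "poly p z = 0" if "z \<in> measure_support \<mu>" for z
    using that fin by (auto simp: p_def poly_prod)
  have "AE \<zeta> in \<mu>. (cmod (poly p \<zeta>))\<^sup>2 = 0"
    by (rule AE_I'[OF null_complement_measure_support[OF sets_circle]]) (auto simp: zero)
  then have "(LINT \<zeta>|\<mu>. (cmod (poly p \<zeta>))\<^sup>2) = 0"
    by (rule integral_eq_zero_AE)
  moreover have "p \<noteq> 0"
    using fin by (auto simp: p_def)
  ultimately show False
    using assms[of p] by (simp add: integral_norm_poly_sq)
qed

lemma singleton_sets: "{1} \<in> sets \<mu>"
proof -
  have "{1::complex} = {1} \<inter> unit_circle" by auto
  then show ?thesis
    unfolding sets_circle by (auto simp: sets_restrict_space intro!: image_eqI[of _ _ "{1}"])
qed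

text \<open>The function |p|^2 dominates the indicator of the point 1.\<close>

lemma measure_singleton_le:
  assumes "poly p 1 = 1"
  shows "measure \<mu> {1} \<le> Re (toeplitz_form m p p)"
proof -
  have "measure \<mu> {1} = (LINT \<zeta>|\<mu>. indicator {1} \<zeta>)"
    using singleton_sets by simp
  also have "\<dots> \<le> (LINT \<zeta>|\<mu>. (cmod (poly p \<zeta>))\<^sup>2)"
  proof (rule integral_mono)
    show "integrable \<mu> (indicator {1} :: complex \<Rightarrow> real)"
      using singleton_sets by (simp add: integrable_indicator_iff less_top[symmetric])
    show "integrable \<mu> (\<lambda>\<zeta>. (cmod (poly p \<zeta>))\<^sup>2)"
      by (intro integrable_circle continuous_intros)
  qed (use assms in \<open>simp add: indicator_def\<close>)
  finally show ?thesis by (simp add: integral_norm_poly_sq)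
qed

text \<open>The averages $\frac1N \sum_{k<N} z^k$ are bounded by 1 and converge on the circle to the
  indicator function of the point 1.\<close>
lemma measure_singleton_ge:
  assumes "\<And>p. r * (cmod (poly p 1))\<^sup>2 \<le> Re (toeplitz_form m p p)"
  shows "r \<le> measure \<mu> {1}"
proof (rule LIMSEQ_le_const)
  define p where "p = (\<lambda>N. smult (1 / of_nat (Suc N)) (\<Sum>k<Suc N. monom 1 k) :: complex poly)"
  have p: "poly (p N) z = (\<Sum>k<Suc N. z ^ k) / of_nat (Suc N)" for N z
    by (simp add: p_def poly_sum poly_monom del: sum.lessThan_Suc of_nat_Suc)
  have p_1: "poly (p N) 1 = 1" for N
    by (simp add: p del: sum.lessThan_Suc of_nat_Suc)
  have bound: "cmod (poly (p N) z) \<le> 1" if "cmod z = 1" for N z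
  proof -
    have "cmod (\<Sum>k<Suc N. z ^ k) \<le> (\<Sum>k<Suc N. cmod (z ^ k))"
      by (rule norm_sum)
    also have "\<dots> = real (Suc N)" using that by (simp add: norm_power)
    finally show ?thesis by (simp add: p norm_divide del: sum.lessThan_Suc of_nat_Suc)
  qed
  have lim: "(\<lambda>N. (cmod (poly (p N) z))\<^sup>2) \<longlonglongrightarrow> indicator {1} z" if z: "cmod z = 1" for z
  proof (cases "z = 1")
    case False
    have "(\<lambda>N. cmod (poly (p N) z)) \<longlonglongrightarrow> 0"
    proof (rule tendsto_sandwich[OF _ _ tendsto_const])
      show "(\<lambda>N. 2 / cmod (z - 1) / real (Suc N)) \<longlonglongrightarrow> 0"
        by (rule LIMSEQ_Suc[OF lim_const_over_n])
      \<comment> \<open>Away from 1, the geometric sum is (z^(N+1) - 1) / (z - 1), with numerator of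
        modulus at most 2.\<close>
      have "cmod (poly (p N) z) \<le> 2 / cmod (z - 1) / real (Suc N)" for N
      proof -
        have "cmod (z ^ Suc N - 1) \<le> cmod (z ^ Suc N) + cmod 1"
          by (rule norm_triangle_ineq4)
        also have "\<dots> = 2"
          unfolding norm_power using z by simp
        finally have "cmod (z ^ Suc N - 1) / cmod (z - 1) \<le> 2 / cmod (z - 1)"
          by (intro divide_right_mono) auto
        then show ?thesis
          unfolding p geometric_sum[OF False] norm_divide norm_of_nat
          by (rule divide_right_mono) (rule of_nat_0_le_iff)
      qed
      then show "eventually (\<lambda>N. cmod (poly (p N) z) \<le> 2 / cmod (z - 1) / real (Suc N)) sequentially"
        by simp
    qed simp
    then have "(\<lambda>N. (cmod (poly (p N) z))\<^sup>2) \<longlonglongrightarrow> 0\<^sup>2" by (rule tendsto_power)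
    with False show ?thesis by simp
  qed (simp add: p_1)
  have "(\<lambda>N. LINT \<zeta>|\<mu>. (cmod (poly (p N) \<zeta>))\<^sup>2) \<longlonglongrightarrow> (LINT \<zeta>|\<mu>. indicator {1} \<zeta>)"
  proof (rule integral_dominated_convergence[where w = "\<lambda>_. 1"])
    show "(\<lambda>\<zeta>. (cmod (poly (p N) \<zeta>))\<^sup>2) \<in> borel_measurable \<mu>" for N
      by (intro measurable_circle continuous_intros)
    show "(indicator {1} :: complex \<Rightarrow> real) \<in> borel_measurable \<mu>"
      using singleton_sets by simp
    show "AE \<zeta> in \<mu>. (\<lambda>N. (cmod (poly (p N) \<zeta>))\<^sup>2) \<longlonglongrightarrow> indicator {1} \<zeta>"
      by (intro AE_I2 lim) (simp add: space_circle)
    show "AE \<zeta> in \<mu>. norm ((cmod (poly (p N) \<zeta>))\<^sup>2) \<le> 1" for N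
      by (intro AE_I2) (simp add: space_circle bound power_le_one)
  qed simp
  then show "(\<lambda>N. LINT \<zeta>|\<mu>. (cmod (poly (p N) \<zeta>))\<^sup>2) \<longlonglongrightarrow> measure \<mu> {1}"
    using singleton_sets by simp
  show "\<exists>N. \<forall>n\<ge>N. r \<le> (LINT \<zeta>|\<mu>. (cmod (poly (p n) \<zeta>))\<^sup>2)"
    unfolding integral_norm_poly_sq using assms[of "p _"] by (auto simp: p_1)
qed

end

section \<open>The representing measure\<close>

theorem theorem4p1:
  fixes c d M :: "nat \<Rightarrow> real"
  assumes "positive_chain_sequence d"
    and "maximal_parameter_sequence d M"
  shows "\<exists>\<mu> :: complex measure.
           nontrivial_circle_probability \<mu> \<and>
           (\<forall>n :: int. moment_functional c d (Poly_Mapping.single (- n) 1) =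
              (LINT \<zeta>|\<mu>. \<zeta> powi (- n) * (1 - \<zeta>))) \<and>
           (M 0 > 0 \<longrightarrow> measure \<mu> {1} = M 0)"
proof -
  define \<nu> where "\<nu> = moment_sequence c d"
  have \<nu>: "is_moment_sequence c d \<nu>"
    unfolding \<nu>_def by (rule is_moment_sequence_moment_sequence)
  obtain m where m_0: "m 0 = 1" and herm: "\<And>k. m (- k) = cnj (m k)"
    and m: "\<And>k. m k - m (k - 1) = \<nu> k"
    using trigonometric_moments[OF \<nu>] by metis
  have M: "parameter_sequence d M"
    using assms(2) by (simp add: maximal_parameter_sequence_def)
  then have M_0: "0 \<le> M 0"
    unfolding parameter_sequence_def by blast
  note b_pos = chain_sol_one_pos[OF M]
  define u where "u = (\<lambda>n. smult (of_real (1 / (2 ^ n * chain_sol d 1 1 n))) (Rpoly c d n))"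
  interpret point_kernels m u "chain_ratio d"
  proof
    show "m (- k) = cnj (m k)" for k by (rule herm)
    show "degree (u n) = n" for n
    proof -
      have "coeff (Rpoly c d n) n \<noteq> 0"
        using cnj_coeff_Rpoly[of n n c d] coeff_Rpoly_0[of c d n] by auto
      then have "degree (Rpoly c d n) = n"
        by (intro antisym degree_Rpoly le_degree)
      then show ?thesis using b_pos[of n] by (simp add: u_def)
    qed
    show "poly (u n) 1 = 1" for n
      using b_pos[of n] by (simp add: u_def poly_Rpoly_1)
    show "poly_act (u n) m k = chain_ratio d n" if "0 \<le> k" "k \<le> int n" for k n
      using b_pos[of n] unfolding u_def poly_act_smult poly_act_Rpoly_moments[OF \<nu> m_0 m that]
      by (simp add: chain_ratio_def)
    show "chain_ratio d n > 0" for n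
      using chain_ratio_gt[OF M, of n] M_0 by linarith
    show "chain_ratio d (Suc n) < chain_ratio d n" for n
      by (rule chain_ratio_decreasing[OF M])
  qed
  \<comment> \<open>Every s_n exceeds \<open>M 0\<close>, so the bound of \<open>form_ge\<close>
    holds with one constant for all degrees.\<close>
  have ge: "M 0 * (cmod (poly p 1))\<^sup>2 \<le> Re (toeplitz_form m p p)" for p
  proof -
    have "M 0 * (cmod (poly p 1))\<^sup>2 \<le> chain_ratio d (degree p) * (cmod (poly p 1))\<^sup>2"
      using chain_ratio_gt[OF M, of "degree p"] by (intro mult_right_mono) auto
    also have "\<dots> \<le> Re (toeplitz_form m p p)"
      by (rule form_ge) simp
    finally show ?thesis .
  qed
  have nonneg: "Re (toeplitz_form m p p) \<ge> 0" for p
    using mult_nonneg_nonneg[OF M_0 zero_le_power2, of "cmod (poly p 1)"] ge[of p] by linarith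
  obtain \<mu> :: "complex measure" where \<mu>: "prob_space \<mu>"
      "sets \<mu> = sets (restrict_space borel unit_circle)"
      "\<And>k. (LINT \<zeta>|\<mu>. \<zeta> powi (- k)) = m k"
    by (rule trigonometric_moment_problem[OF m_0 herm nonneg]) blast
  interpret circle_moments \<mu> m
    using \<mu> by (simp add: circle_moments_def circle_moments_axioms_def)
  have "nontrivial_circle_probability \<mu>"
    unfolding nontrivial_circle_probability_def
    using \<mu> infinite_measure_support[OF form_pos] by blast
  moreover have "moment_functional c d (Poly_Mapping.single (- n) 1) =
      (LINT \<zeta>|\<mu>. \<zeta> powi (- n) * (1 - \<zeta>))" for n
  proof -
    have "(LINT \<zeta>|\<mu>. \<zeta> powi (- n) * (1 - \<zeta>)) = (LINT \<zeta>|\<mu>. \<zeta> powi (- n) - \<zeta> powi (- (n - 1)))"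
    proof (rule Bochner_Integration.integral_cong[OF refl])
      fix \<zeta> assume "\<zeta> \<in> space \<mu>"
      then have "\<zeta> \<noteq> 0" by (auto simp: space_circle)
      then show "\<zeta> powi (- n) * (1 - \<zeta>) = \<zeta> powi (- n) - \<zeta> powi (- (n - 1))"
        by (simp add: power_int_add_1[symmetric] right_diff_distrib)
    qed
    also have "\<dots> = (LINT \<zeta>|\<mu>. \<zeta> powi (- n)) - (LINT \<zeta>|\<mu>. \<zeta> powi (- (n - 1)))"
      by (intro Bochner_Integration.integral_diff integrable_circle continuous_intros) auto
    also have "\<dots> = m n - m (n - 1)"
      unfolding moments ..
    finally show ?thesis
      by (simp only: moment_functional_monomial m \<nu>_def)
  qed
  moreover have "measure \<mu> {1} = M 0"
  proof (rule antisym)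
    show "M 0 \<le> measure \<mu> {1}"
      by (rule measure_singleton_ge[OF ge])
    \<comment> \<open>The test polynomial \<open>u n\<close> has the value 1 at 1 and the integral
      s_n of its squared modulus.\<close>
    have "measure \<mu> {1} \<le> chain_ratio d n" for n
      using measure_singleton_le[OF poly_u_1, of n] form_u[of "u n" n]
      by (simp add: degree_u poly_u_1)
    then show "measure \<mu> {1} \<le> M 0"
      using chain_ratio_tendsto[OF assms(2)] by (intro LIMSEQ_le_const) auto
  qed
  ultimately show ?thesis by blast
qed

end
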